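(* Let $\Gamma$ be a quiver of mutation type $A_n$ whose vertices have been labelled $1,\ldots,n$ according to the type $A$ labelling procedure (for any choices of end vertices made in that procedure), and let $\Phi$ be the root system of type $A_n$ with simple system $\Pi=\{\alpha_1,\ldots,\alpha_n\}$. Identify vertices with their labels. Then the set $\{\beta_i : i\in\Gamma_0\}\subseteq\Phi$ given by $$\beta_i=\begin{cases}\alpha_i+\ldots+\alpha_{i+a} & \text{if } i \text{ is a primary vertex and } i+a \text{ is the complementary vertex corresponding to } i,\\ \alpha_i & \text{if } i \text{ is not a primary vertex}\end{cases}$$ is a companion basis for $\Gamma$.
   Context: **Mutation type.** For a simply-laced Dynkin diagram $\Delta$, a quiver is of mutation type $\Delta$ if it is obtained by a finite sequence of (Fomin--Zelevinsky) quiver mutations from a quiver whose underlying graph is $\Delta$. $\Gamma_0$ denotes the vertex set of $\Gamma$. **Root system.** $\Phi$ is the root system of type $A_n$, with inner product $(\cdot,\cdot)$ normalized so that $(\alpha,\alpha)=2$ for all roots $\alpha$; the simple roots are numbered so that $\alpha_i$ and $\alpha_{i+1}$ are adjacent in the Dynkin diagram for $1\le i\le n-1$. **Companion basis.** A companion basis for a quiver $\Gamma$ of mutation type $\Delta$ is a subset $\{\gamma_x : x\in\Gamma_0\}\subseteq\Phi$ (with $\Phi$ the root system of type $\Delta$) whose elements form a $\mathbb{Z}$-basis of the root lattice $\mathbb{Z}\Phi$ and such that for all distinct $x,y\in\Gamma_0$, $|(\gamma_x,\gamma_y)|$ equals the number of edges joining $x$ and $y$ in the underlying unoriented graph of $\Gamma$.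 **Structure of type $A$ quivers (known facts making the definitions below meaningful).** A quiver $\Gamma$ of mutation type $A_n$ is connected; the only cycles in its underlying graph are 3-cycles, each of which is cyclically oriented in $\Gamma$; every vertex has valency at most four and lies on at most two 3-cycles. A 3-cycle vertex is a vertex belonging to a cyclically oriented 3-cycle. An end vertex is a vertex that has valency zero, or valency one, or is a 3-cycle vertex of valency two; if $n\ge 2$ there are at least two end vertices. A string in $\Gamma$ is a reduced walk in $\Gamma$ that does not contain two consecutive arrows of any given 3-cycle; for any $i,j\in\Gamma_0$ there is a unique string from $i$ to $j$ (the trivial string if $i=j$), and it visits no vertex twice. **Relative terminology.** Let $p$ be a string from $i$ to $j$. For a 3-cycle with two vertices appearing in $p$, the first of these met when moving along $p$ from $i$ to $j$ is a primary vertex relative to $p$, the second is the secondary vertex corresponding to it relative to $p$, and the vertex of the 3-cycle not on $p$ is the complementary vertex corresponding to it relative to $p$. If $x,y,z$ are the vertices of a 3-cycle, the subquiver of $\Gamma$ rooted at $x$ is the full subquiver on all vertices that can be reached on strings starting at $x$ which do not pass through $y$ or $z$; it is again a quiver of mutation type $A$ (with fewer vertices), and $x$ is an end vertex of it. **Labelling procedure (type $A$).** The input is a quiver $\Gamma$ of mutation type $A_n$ and an ordered pair of end vertices of $\Gamma$, distinct if $n\ge 2$. If $n=1$, label the vertex $1$. If $n\ge 2$ with pair $(e,f)$, label $e$ by $1$ and let $p$ be the string from $e$ to $f$; move along $p$ from $e$ to $f$. If the current vertex has label $\ell$ and is not a primary vertex relative to $p$, label the next vertex of $p$ by $\ell+1$.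 If the current vertex has label $\ell$ and is a primary vertex relative to $p$ with corresponding complementary vertex $z$, let $\Gamma'$ be the subquiver of $\Gamma$ rooted at $z$ and let $a$ be its number of vertices; choose an end vertex $z'$ of $\Gamma'$, distinct from $z$ if $a>1$; recursively label $\Gamma'$ with $1,\ldots,a$ using the ordered pair $(z',z)$; add $\ell$ to each of these labels and assign the results to the corresponding vertices of $\Gamma$; then label the next vertex on $p$ (the corresponding secondary vertex) by $\ell+a+1$. Continue until $f$ is labelled; it gets the label $n$. **Vertex types in the labelled quiver.** If the vertices of a 3-cycle in the labelled quiver $\Gamma$ have labels $i<j<k$, then $i$ is called a primary vertex, $j$ a complementary vertex (the complementary vertex corresponding to $i$), and $k$ a secondary vertex (the secondary vertex corresponding to $i$). *)

theory Defs
  imports "HOL-Analysis.Analysis"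
begin

section \<open>Quivers and mutation\<close>

text \<open>A quiver is given by its vertex set and the function counting the arrows from one
  vertex to another. As usual for Fomin--Zelevinsky mutation, quivers are finite and have
  neither loops nor oriented 2-cycles.\<close>

record 'v quiver =
  verts :: "'v set"
  arrows :: "'v \<Rightarrow> 'v \<Rightarrow> nat"

definition wf_quiver :: "'v quiver \<Rightarrow> bool" where
  "wf_quiver Q \<longleftrightarrow> finite (verts Q) \<and>
     (\<forall>x y. arrows Q x y > 0 \<longrightarrow> x \<in> verts Q \<and> y \<in> verts Q) \<and>
     (\<forall>x. arrows Q x x = 0) \<and>
     (\<forall>x y. arrows Q x y = 0 \<or> arrows Q y x = 0)"

definition edges :: "'v quiver \<Rightarrow> 'v \<Rightarrow> 'v \<Rightarrow> nat" where
  "edges Q x y = arrows Q x y + arrows Q y x"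

definition has_graph_A :: "nat \<Rightarrow> 'v quiver \<Rightarrow> bool" where
  "has_graph_A n Q \<longleftrightarrow> n \<ge> 1 \<and> wf_quiver Q \<and>
     (\<exists>\<phi>. bij_betw \<phi> (verts Q) {1..n} \<and>
       (\<forall>x\<in>verts Q. \<forall>y\<in>verts Q.
          edges Q x y = (if \<phi> y = \<phi> x + 1 \<or> \<phi> x = \<phi> y + 1 then 1 else 0)))"

text \<open>Mutation at \<open>k\<close>: each path from \<open>x\<close> through \<open>k\<close> to \<open>y\<close> contributes a new arrow from
  \<open>x\<close> to \<open>y\<close>; arrows at \<open>k\<close> are reversed; 2-cycles are cancelled, which is what the truncated
  subtraction on \<^typ>\<open>nat\<close> does.\<close>

definition mutate :: "'v \<Rightarrow> 'v quiver \<Rightarrow> 'v quiver" where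
  "mutate k Q = \<lparr> verts = verts Q,
     arrows = (\<lambda>x y. if x = k \<or> y = k then arrows Q y x
                     else (arrows Q x y + arrows Q x k * arrows Q k y)
                        - (arrows Q y x + arrows Q y k * arrows Q k x)) \<rparr>"

inductive mutation_type_A :: "nat \<Rightarrow> 'v quiver \<Rightarrow> bool" for n :: nat where
  base: "has_graph_A n Q \<Longrightarrow> mutation_type_A n Q"
| mutation: "mutation_type_A n Q \<Longrightarrow> k \<in> verts Q \<Longrightarrow> mutation_type_A n (mutate k Q)"


section \<open>Root systems of type A and companion bases\<close>

text \<open>A reduced crystallographic root system in the Euclidean space \<^term>\<open>span \<Phi>\<close>; it is not
  required to span the ambient type.\<close>

definition root_system :: "'e::real_inner set \<Rightarrow> bool" where
  "root_system \<Phi> \<longleftrightarrow> finite \<Phi> \<and> 0 \<notin> \<Phi> \<and>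
     (\<forall>\<rho>\<in>\<Phi>. \<forall>c. c *\<^sub>R \<rho> \<in> \<Phi> \<longrightarrow> c = 1 \<or> c = - 1) \<and>
     (\<forall>\<rho>\<in>\<Phi>. \<forall>\<sigma>\<in>\<Phi>. \<sigma> - (2 * (\<sigma> \<bullet> \<rho>) / (\<rho> \<bullet> \<rho>)) *\<^sub>R \<rho> \<in> \<Phi>) \<and>
     (\<forall>\<rho>\<in>\<Phi>. \<forall>\<sigma>\<in>\<Phi>. 2 * (\<sigma> \<bullet> \<rho>) / (\<rho> \<bullet> \<rho>) \<in> \<int>)"

definition simple_system :: "'e::real_inner set \<Rightarrow> 'e set \<Rightarrow> bool" where
  "simple_system \<Phi> \<Delta> \<longleftrightarrow> \<Delta> \<subseteq> \<Phi> \<and> independent \<Delta> \<and>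
     (\<forall>\<rho>\<in>\<Phi>. \<exists>c :: 'e \<Rightarrow> int. \<rho> = (\<Sum>\<delta>\<in>\<Delta>. of_int (c \<delta>) *\<^sub>R \<delta>) \<and>
        ((\<forall>\<delta>\<in>\<Delta>. c \<delta> \<ge> 0) \<or> (\<forall>\<delta>\<in>\<Delta>. c \<delta> \<le> 0)))"

text \<open>\<open>\<Phi>\<close> is a root system of type \<open>A\<^sub>n\<close>, all roots having squared length 2, with simple
  system \<open>\<alpha> 1, \<dots>, \<alpha> n\<close> numbered along the Dynkin diagram.\<close>

definition root_system_A :: "nat \<Rightarrow> 'e::real_inner set \<Rightarrow> (nat \<Rightarrow> 'e) \<Rightarrow> bool" where
  "root_system_A n \<Phi> \<alpha> \<longleftrightarrow> root_system \<Phi> \<and> (\<forall>\<rho>\<in>\<Phi>. \<rho> \<bullet> \<rho> = 2) \<and>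
     inj_on \<alpha> {1..n} \<and> simple_system \<Phi> (\<alpha> ` {1..n}) \<and>
     (\<forall>i\<in>{1..n}. \<forall>j\<in>{1..n}. i \<noteq> j \<longrightarrow>
        \<alpha> i \<bullet> \<alpha> j = (if j = i + 1 \<or> i = j + 1 then - 1 else 0))"

text \<open>The real vector space viewed as a \<open>\<int>\<close>-module: \<open>int_mod.span \<Phi>\<close> is the root lattice.\<close>

interpretation int_mod: module "\<lambda>(k::int) (v::'e::real_vector). of_int k *\<^sub>R v"
  by unfold_locales (simp_all add: algebra_simps)

definition int_basis_of :: "('v \<Rightarrow> 'e::real_vector) \<Rightarrow> 'v set \<Rightarrow> 'e set \<Rightarrow> bool" where
  "int_basis_of \<gamma> X M \<longleftrightarrow> inj_on \<gamma> X \<and> int_mod.independent (\<gamma> ` X) \<and> int_mod.span (\<gamma> ` X) = M"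

definition companion_basis :: "'v quiver \<Rightarrow> 'e::real_inner set \<Rightarrow> ('v \<Rightarrow> 'e) \<Rightarrow> bool" where
  "companion_basis Q \<Phi> \<gamma> \<longleftrightarrow> \<gamma> ` verts Q \<subseteq> \<Phi> \<and>
     int_basis_of \<gamma> (verts Q) (int_mod.span \<Phi>) \<and>
     (\<forall>x\<in>verts Q. \<forall>y\<in>verts Q. x \<noteq> y \<longrightarrow> \<bar>\<gamma> x \<bullet> \<gamma> y\<bar> = real (edges Q x y))"


section \<open>Structure of type A quivers\<close>

text \<open>The vertices \<open>x\<close>, \<open>y\<close>, \<open>z\<close>, in any order, form a cyclically oriented 3-cycle.\<close>

definition three_cycle :: "'v quiver \<Rightarrow> 'v \<Rightarrow> 'v \<Rightarrow> 'v \<Rightarrow> bool" where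
  "three_cycle Q x y z \<longleftrightarrow> distinct [x, y, z] \<and>
     (arrows Q x y > 0 \<and> arrows Q y z > 0 \<and> arrows Q z x > 0 \<or>
      arrows Q x z > 0 \<and> arrows Q z y > 0 \<and> arrows Q y x > 0)"

definition valency :: "'v quiver \<Rightarrow> 'v \<Rightarrow> nat" where
  "valency Q x = (\<Sum>y\<in>verts Q. edges Q x y)"

definition end_vertex :: "'v quiver \<Rightarrow> 'v \<Rightarrow> bool" where
  "end_vertex Q x \<longleftrightarrow> x \<in> verts Q \<and>
     (valency Q x = 0 \<or> valency Q x = 1 \<or> valency Q x = 2 \<and> (\<exists>y z. three_cycle Q x y z))"

text \<open>Walks are lists of vertices, which suffices since quivers of mutation type A have no
  multiple edges. Accordingly, two consecutive edges of a reduced walk lie on a common 3-cycle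
  iff the three vertices visited form a 3-cycle.\<close>

definition string_from_to :: "'v quiver \<Rightarrow> 'v list \<Rightarrow> 'v \<Rightarrow> 'v \<Rightarrow> bool" where
  "string_from_to Q p i j \<longleftrightarrow> p \<noteq> [] \<and> hd p = i \<and> last p = j \<and> set p \<subseteq> verts Q \<and>
     (\<forall>k. k + 1 < length p \<longrightarrow> edges Q (p ! k) (p ! (k + 1)) > 0) \<and>
     (\<forall>k. k + 2 < length p \<longrightarrow> p ! k \<noteq> p ! (k + 2) \<and>
        \<not> three_cycle Q (p ! k) (p ! (k + 1)) (p ! (k + 2)))"

text \<open>Relative to the string \<open>p\<close>, the vertex \<open>x\<close> is primary with corresponding secondary
  vertex \<open>y\<close> and complementary vertex \<open>z\<close>.\<close>

definition relative_types :: "'v quiver \<Rightarrow> 'v list \<Rightarrow> 'v \<Rightarrow> 'v \<Rightarrow> 'v \<Rightarrow> bool" where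
  "relative_types Q p x y z \<longleftrightarrow> three_cycle Q x y z \<and> z \<notin> set p \<and>
     (\<exists>k l. k < l \<and> l < length p \<and> p ! k = x \<and> p ! l = y)"

definition full_subquiver :: "'v quiver \<Rightarrow> 'v set \<Rightarrow> 'v quiver" where
  "full_subquiver Q S = \<lparr> verts = S,
     arrows = (\<lambda>u v. if u \<in> S \<and> v \<in> S then arrows Q u v else 0) \<rparr>"

text \<open>The subquiver rooted at \<open>x\<close>, where \<open>x\<close>, \<open>y\<close>, \<open>z\<close> form a 3-cycle.\<close>

definition rooted_subquiver :: "'v quiver \<Rightarrow> 'v \<Rightarrow> 'v \<Rightarrow> 'v \<Rightarrow> 'v quiver" where
  "rooted_subquiver Q x y z = full_subquiver Q
     {v \<in> verts Q. \<exists>p. string_from_to Q p x v \<and> y \<notin> set p \<and> z \<notin> set p}"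


section \<open>The labelling procedure\<close>

text \<open>\<open>labelling Q e f L\<close>: running the procedure on \<open>Q\<close> and the ordered pair \<open>(e, f)\<close> can
  produce the labels \<open>L\<close>, for some choices of end vertices in the recursive calls. Only the
  values of \<open>L\<close> on \<^term>\<open>verts Q\<close> are constrained.\<close>

inductive labelling :: "'v quiver \<Rightarrow> 'v \<Rightarrow> 'v \<Rightarrow> ('v \<Rightarrow> nat) \<Rightarrow> bool" where
  single: "verts Q = {v} \<Longrightarrow> L v = 1 \<Longrightarrow> labelling Q v v L"
| string:
  "\<lbrakk> card (verts Q) \<ge> 2; end_vertex Q e; end_vertex Q f; e \<noteq> f;
     string_from_to Q p e f; L e = 1;
     \<forall>k. k + 1 < length p \<and> \<not> (\<exists>y z. relative_types Q p (p ! k) y z) \<longrightarrow>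
       L (p ! (k + 1)) = L (p ! k) + 1;
     \<forall>k y z. k + 1 < length p \<and> relative_types Q p (p ! k) y z \<longrightarrow>
       (\<exists>z' L'.
          end_vertex (rooted_subquiver Q z (p ! k) y) z' \<and>
          (card (verts (rooted_subquiver Q z (p ! k) y)) > 1 \<longrightarrow> z' \<noteq> z) \<and>
          labelling (rooted_subquiver Q z (p ! k) y) z' z L' \<and>
          (\<forall>v \<in> verts (rooted_subquiver Q z (p ! k) y). L v = L (p ! k) + L' v) \<and>
          L (p ! (k + 1)) = L (p ! k) + card (verts (rooted_subquiver Q z (p ! k) y)) + 1) \<rbrakk>
   \<Longrightarrow> labelling Q e f L"


section \<open>The roots attached to a labelled quiver\<close>

text \<open>In the labelled quiver, \<open>y\<close> is the complementary vertex corresponding to the primary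
  vertex \<open>x\<close>.\<close>

definition complementary_of :: "'v quiver \<Rightarrow> ('v \<Rightarrow> nat) \<Rightarrow> 'v \<Rightarrow> 'v \<Rightarrow> bool" where
  "complementary_of Q L x y \<longleftrightarrow> (\<exists>z. three_cycle Q x y z \<and> L x < L y \<and> L y < L z)"

definition primary_vertex :: "'v quiver \<Rightarrow> ('v \<Rightarrow> nat) \<Rightarrow> 'v \<Rightarrow> bool" where
  "primary_vertex Q L x \<longleftrightarrow> (\<exists>y. complementary_of Q L x y)"

definition label_root ::
  "'v quiver \<Rightarrow> ('v \<Rightarrow> nat) \<Rightarrow> (nat \<Rightarrow> 'e::real_inner) \<Rightarrow> 'v \<Rightarrow> 'e" where
  "label_root Q L \<alpha> x =
     (if primary_vertex Q L x
      then \<Sum>m = L x..L (THE y. complementary_of Q L x y). \<alpha> m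
      else \<alpha> (L x))"

end

theory Submission
  imports Defs
begin

text \<open>The quivers of mutation type \<open>A\<^sub>n\<close> are the line graphs of trees with \<open>n\<close> edges and maximal degree
  3, the triangle at each tree vertex of degree 3 being cyclically oriented: a mutation only slides
  some edges of the tree along another one. In a root system of type \<open>A\<^sub>n\<close> the root
  \<open>\<alpha>\<^sub>i + \<dots> + \<alpha>\<^bsub>j-1\<^esub>\<close> corresponds to the pair \<open>{i, j}\<close> in \<open>{1, \<dots>, n + 1}\<close>, and two such roots with
  different left end points have inner product \<open>\<plusminus>1\<close> if their pairs meet and 0 otherwise. So it suffices
  to number the tree vertices by \<open>1, \<dots>, n + 1\<close> in such a way that every tree edge becomes the pair
  of its root. Along a string the tree vertices receive the labels of the string vertices, and the
  last one receives \<open>n + 1\<close>; the subtrees hanging off the string are numbered recursively.\<close>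

section \<open>Quivers of mutation type A as line graphs of trees\<close>

text \<open>What makes the recursive numberings fit together is the order of the pair in the
  recursive call. A subquiver with \<open>a\<close> vertices rooted at the complementary vertex
  \<open>z\<close> is labelled along a string that ends in \<open>z\<close>, so the tree vertex
  where this subtree hangs is the last one of its numbering and gets \<open>a + 1\<close>. After the
  shift by the label \<open>l\<close> of the primary vertex this is \<open>l + a + 1\<close>, the
  label of the secondary vertex, which is also the number that the string itself gives to that tree
  vertex. The tree edge of the primary vertex therefore joins \<open>l\<close> and
  \<open>l + a + 1\<close>, and its root ends at the index \<open>l + a\<close>, the label of
  \<open>z\<close>. Acyclicity has to survive mutation. Carrying a cut for every edge turns each
  argument against a cycle into a comparison of sides, without walks in the tree; connectedness is
  likewise stated through sets of tree vertices whose boundary no edge crosses.\<close>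

text \<open>\<open>C x\<close> is one side of the cut obtained by deleting the tree edge \<open>E x\<close>: that every edge is such
  a bridge says that there are no cycles. Condition \<open>cyclic\<close> bounds the degrees of the tree by 3
  (lemma \<open>at_most_three\<close>).\<close>

locale tree_quiver =
  fixes Q :: "'v quiver" and E :: "'v \<Rightarrow> nat set" and C :: "'v \<Rightarrow> nat set"
  assumes fin: "finite (verts Q)"
    and arrows_verts: "arrows Q x y > 0 \<Longrightarrow> x \<in> verts Q \<and> y \<in> verts Q"
    and arrows_anti: "arrows Q x y = 0 \<or> arrows Q y x = 0"
    and card_E: "x \<in> verts Q \<Longrightarrow> card (E x) = 2"
    and edges_eq: "x \<in> verts Q \<Longrightarrow> y \<in> verts Q \<Longrightarrow> x \<noteq> y \<Longrightarrow>
      edges Q x y = (if E x \<inter> E y = {} then 0 else 1)"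
    and cyclic: "x \<in> verts Q \<Longrightarrow> y \<in> verts Q \<Longrightarrow> z \<in> verts Q \<Longrightarrow> distinct [x, y, z] \<Longrightarrow>
      w \<in> E x \<Longrightarrow> w \<in> E y \<Longrightarrow> w \<in> E z \<Longrightarrow> arrows Q x y > 0 \<Longrightarrow> arrows Q y z > 0"
    and cut_same: "x \<in> verts Q \<Longrightarrow> y \<in> verts Q \<Longrightarrow> x \<noteq> y \<Longrightarrow> a \<in> E y \<Longrightarrow> b \<in> E y \<Longrightarrow>
      a \<in> C x \<longleftrightarrow> b \<in> C x"
    and cut_diff: "x \<in> verts Q \<Longrightarrow> a \<in> E x \<Longrightarrow> b \<in> E x \<Longrightarrow> a \<noteq> b \<Longrightarrow> a \<in> C x \<longleftrightarrow> b \<notin> C x"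
    and conn: "(\<And>y. y \<in> verts Q \<Longrightarrow> E y \<subseteq> A \<or> E y \<inter> A = {}) \<Longrightarrow>
      x \<in> verts Q \<Longrightarrow> E x \<subseteq> A \<Longrightarrow> y \<in> verts Q \<Longrightarrow> E y \<subseteq> A"
begin

lemma other_end:
  assumes "x \<in> verts Q" "a \<in> E x"
  obtains b where "b \<noteq> a" "E x = {a, b}"
proof -
  obtain c d where "E x = {c, d}" "c \<noteq> d"
    using card_E[OF assms(1)] by (auto simp: card_2_iff)
  then show ?thesis using assms(2) that[of c] that[of d] by auto
qed

text \<open>Parallel edges are impossible: the cut of \<open>x\<close> separates the two ends of
  \<open>x\<close>, but never the two ends of another edge.\<close>

lemma shared_unique:
  assumes "x \<in> verts Q" "y \<in> verts Q" "x \<noteq> y" "a \<in> E x" "a \<in> E y" "b \<in> E x" "b \<in> E y"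
  shows "a = b"
  using assms cut_same cut_diff by blast

text \<open>The edges \<open>y\<close> and \<open>z\<close> lead from \<open>a\<close> over
  \<open>c\<close> to \<open>b\<close> without using \<open>x\<close>, so the cut of
  \<open>x\<close> does not separate \<open>a\<close> from \<open>b\<close>.\<close>

lemma no_long_cycle:
  assumes "x \<in> verts Q" "y \<in> verts Q" "z \<in> verts Q" "x \<noteq> y" "x \<noteq> z"
    and "a \<in> E x" "a \<in> E y" "b \<in> E x" "b \<in> E z" "c \<in> E y" "c \<in> E z"
  shows "a = b"
  using assms cut_same[of x y a c] cut_same[of x z b c] cut_diff[of x a b] by blast

lemma not_self [simp]: "arrows Q x x = 0"
  using arrows_anti by blast

lemma adjacent_iff:
  assumes "x \<in> verts Q" "y \<in> verts Q" "x \<noteq> y"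
  shows "E x \<inter> E y \<noteq> {} \<longleftrightarrow> arrows Q x y > 0 \<or> arrows Q y x > 0"
  using edges_eq[OF assms] by (auto simp: edges_def split: if_splits)

lemma arrows_le_1: "arrows Q x y \<le> 1"
proof (cases "arrows Q x y > 0")
  case True
  then have "x \<in> verts Q" "y \<in> verts Q" "x \<noteq> y" using arrows_verts by force+
  then show ?thesis using edges_eq[of x y] by (auto simp: edges_def split: if_splits)
qed auto

text \<open>Pairwise adjacent edges of a tree meet in one vertex, and \<open>cyclic\<close> orients
  the triangle there. Thus 3-cycles correspond to tree vertices of degree 3.\<close>

lemma three_cycle_iff:
  "three_cycle Q x y z \<longleftrightarrow> x \<in> verts Q \<and> y \<in> verts Q \<and> z \<in> verts Q \<and> distinct [x, y, z] \<and>
     (\<exists>w. w \<in> E x \<and> w \<in> E y \<and> w \<in> E z)" (is "?l \<longleftrightarrow> ?r")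
proof
  assume l: ?l
  then have V: "x \<in> verts Q" "y \<in> verts Q" "z \<in> verts Q" "distinct [x, y, z]"
    using arrows_verts by (auto simp: three_cycle_def)
  have "E x \<inter> E y \<noteq> {}" "E x \<inter> E z \<noteq> {}" "E y \<inter> E z \<noteq> {}"
    using adjacent_iff[of x y] adjacent_iff[of x z] adjacent_iff[of y z] V l
    by (auto simp: three_cycle_def)
  then show ?r using V no_long_cycle[of x y z] by fastforce
next
  assume ?r
  then obtain w where V: "x \<in> verts Q" "y \<in> verts Q" "z \<in> verts Q" "distinct [x, y, z]"
    and w: "w \<in> E x" "w \<in> E y" "w \<in> E z" by blast
  have "arrows Q x y > 0 \<or> arrows Q y x > 0"
    using adjacent_iff[of x y] V w by auto
  then show ?l
  proof
    assume "arrows Q x y > 0"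
    then have "arrows Q y z > 0" "arrows Q z x > 0"
      using V w cyclic[of x y z w] cyclic[of y z x w] by auto
    then show ?l using V \<open>arrows Q x y > 0\<close> by (simp add: three_cycle_def)
  next
    assume "arrows Q y x > 0"
    then have "arrows Q x z > 0" "arrows Q z y > 0"
      using V w cyclic[of y x z w] cyclic[of x z y w] by auto
    then show ?l using V \<open>arrows Q y x > 0\<close> by (simp add: three_cycle_def)
  qed
qed

end

section \<open>The linear quiver, and the effect of a mutation on the tree\<close>

lemma tree_quiver_line:
  assumes "has_graph_A n Q"
  shows "card (verts Q) = n \<and> (\<exists>E C. tree_quiver Q E C)"
proof -
  obtain \<phi> where bij: "bij_betw \<phi> (verts Q) {1..n}"
    and ed: "\<And>x y. x \<in> verts Q \<Longrightarrow> y \<in> verts Q \<Longrightarrow>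
          edges Q x y = (if \<phi> y = \<phi> x + 1 \<or> \<phi> x = \<phi> y + 1 then 1 else 0)"
    and wf: "wf_quiver Q"
    using assms by (auto simp: has_graph_A_def)
  have inj: "\<phi> x = \<phi> y \<longleftrightarrow> x = y" if "x \<in> verts Q" "y \<in> verts Q" for x y
    using bij that by (auto simp: bij_betw_def inj_on_def)
  \<comment> \<open>The tree is the path on \<open>1, ..., n + 1\<close>. No three of its edges
    share a vertex, so \<open>cyclic\<close> holds vacuously.\<close>
  define E where "E x = {\<phi> x, Suc (\<phi> x)}" for x
  define C where "C x = {..\<phi> x}" for x
  have "tree_quiver Q E C"
  proof
    fix A x y
    assume A: "\<And>y. y \<in> verts Q \<Longrightarrow> E y \<subseteq> A \<or> E y \<inter> A = {}"
      and x: "x \<in> verts Q" "E x \<subseteq> A" and y: "y \<in> verts Q"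
    have step: "i \<in> A \<longleftrightarrow> Suc i \<in> A" if "i \<in> {1..n}" for i
    proof -
      have "i \<in> \<phi> ` verts Q" using that bij_betw_imp_surj_on[OF bij] by simp
      then obtain v where "v \<in> verts Q" "\<phi> v = i" by blast
      then show ?thesis using A[of v] by (auto simp: E_def)
    qed
    have all: "i \<in> A \<longleftrightarrow> 1 \<in> A" if "1 \<le> i" "i \<le> n" for i
      using that by (induction i rule: dec_induct) (use step in auto)
    have "\<phi> x \<in> {1..n}" "\<phi> y \<in> {1..n}" using x y bij by (auto simp: bij_betw_def)
    then show "E y \<subseteq> A" using all[of "\<phi> x"] all[of "\<phi> y"] step[of "\<phi> y"] x(2) by (auto simp: E_def)
  next
    fix x y a b
    assume "x \<in> verts Q" "y \<in> verts Q" "x \<noteq> y" and ab: "a \<in> E y" "b \<in> E y"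
    then have "\<phi> x \<noteq> \<phi> y" using inj by simp
    then show "a \<in> C x \<longleftrightarrow> b \<in> C x" using ab by (auto simp: E_def C_def)
  next
    fix x y z w
    assume "x \<in> verts Q" "y \<in> verts Q" "z \<in> verts Q" and d: "distinct [x, y, z]"
      and "w \<in> E x" "w \<in> E y" "w \<in> E z"
    then show "arrows Q y z > 0" using inj[of x y] inj[of x z] inj[of y z] by (auto simp: E_def)
  qed (use wf ed inj in \<open>auto simp: wf_quiver_def E_def C_def\<close>)
  then show ?thesis using bij by (auto dest: bij_betw_same_card)
qed

text \<open>Additivity of parity. For cuts it says that two points lie on different sides of a
  symmetric difference of cuts iff an odd number of these cuts separate them.\<close>

lemma odd_card_neq_iff:
  assumes "finite S"
  shows "odd (card {z \<in> S. P z}) \<noteq> odd (card {z \<in> S. R z}) \<longleftrightarrow> odd (card {z \<in> S. P z \<noteq> R z})"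
  using assms
proof induction
  case (insert x S)
  have "{z \<in> insert x S. T z} = (if T x then insert x {z \<in> S. T z} else {z \<in> S. T z})" for T
    by auto
  then show ?case using insert by auto
qed auto

context tree_quiver
begin

lemma arrows_mutate:
  "arrows (mutate k Q) x y =
     (if x = k \<or> y = k then arrows Q y x
      else (arrows Q x y + arrows Q x k * arrows Q k y) - (arrows Q y x + arrows Q y k * arrows Q k x))"
  by (simp add: mutate_def)

text \<open>Mutation at \<open>k\<close> slides every tree edge \<open>y\<close> with \<open>k \<rightarrow> y\<close> along \<open>k\<close> to the other end of \<open>k\<close>.
  Only the cut of \<open>k\<close> changes: it becomes the symmetric difference of the old cuts of \<open>k\<close> and of
  the moved edges.\<close>

lemma mutate_tree_quiver:
  assumes k: "k \<in> verts Q"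
  shows "\<exists>E' C'. tree_quiver (mutate k Q) E' C'"
proof -
  obtain u v where Ek: "E k = {u, v}" and uv: "u \<noteq> v"
    using card_E[OF k] by (auto simp: card_2_iff)
  define \<tau> where "\<tau> = Transposition.transpose u v"
  define M where "M = {y \<in> verts Q. arrows Q k y > 0}"
  define E' where "E' y = (if y \<in> M then \<tau> ` E y else E y)" for y
  \<comment> \<open>Odd membership is membership in the symmetric difference. Which side
    \<open>C y\<close> denotes is immaterial, since complementing one cut only complements the
    result.\<close>
  define C' where "C' x = (if x = k then {a. odd (card {y \<in> insert k M. a \<in> C y})} else C x)" for x
  have kM: "k \<notin> M" by (simp add: M_def)
  have finM: "finite M" using fin by (simp add: M_def)
  have inj: "inj \<tau>" by (simp add: \<tau>_def)
  have \<tau>uv: "\<tau> u = v" "\<tau> v = u" and \<tau>id: "a \<noteq> u \<Longrightarrow> a \<noteq> v \<Longrightarrow> \<tau> a = a" for a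
    by (simp_all add: \<tau>_def transpose_apply_other)
  have EM: "\<exists>p q a. {p, q} = {u, v} \<and> a \<noteq> u \<and> a \<noteq> v \<and> E x = {a, p}"
    if x: "x \<in> verts Q" "x \<noteq> k" "arrows Q x k > 0 \<or> arrows Q k x > 0" for x
  proof -
    obtain p where p: "p \<in> E x" "p \<in> {u, v}"
      using adjacent_iff[of x k] x k Ek by auto
    obtain a where a: "a \<noteq> p" "E x = {p, a}" using other_end[OF x(1) p(1)] .
    have "a \<notin> {u, v}" using shared_unique[of x k a p] x k Ek p a by auto
    then have "{p, if p = u then v else u} = {u, v} \<and> a \<noteq> u \<and> a \<noteq> v \<and> E x = {a, p}" using p a uv by auto
    then show ?thesis by blast
  qed
  have nonadj: "E x \<inter> {u, v} = {}" if "x \<in> verts Q" "x \<noteq> k" "arrows Q x k = 0" "arrows Q k x = 0" for x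
    using adjacent_iff[of x k] that k Ek by auto
  have \<tau>\<tau>: "\<tau> (\<tau> a) = a" for a by (simp add: \<tau>_def)
  have E'k: "E' k = {u, v}" using kM Ek by (simp add: E'_def)
  \<comment> \<open>For \<open>x -> k -> y\<close> the slide toggles adjacency. If \<open>x\<close>
    and \<open>y\<close> sit at the same end of \<open>k\<close>, the triangle contains an arrow
    \<open>y -> x\<close>, which the new arrow cancels while \<open>y\<close> slides away from
    \<open>x\<close>. If they sit at opposite ends, the slide brings them together.\<close>
  have pair_out_in:
    "arrows (mutate k Q) x y = (if E x \<inter> E y = {} then 1 else 0) \<and> arrows (mutate k Q) y x = 0 \<and>
     (E' x \<inter> E' y = {} \<longleftrightarrow> E x \<inter> E y \<noteq> {})"
    if x: "x \<in> verts Q" and y: "y \<in> verts Q" and "x \<noteq> y" and xk: "arrows Q x k > 0" and ky: "arrows Q k y > 0"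
    for x y
  proof -
    have ne: "x \<noteq> k" "y \<noteq> k" using xk ky by auto
    have z: "arrows Q k x = 0" "arrows Q y k = 0" "arrows Q x k = 1" "arrows Q k y = 1"
      using arrows_anti[of x k] arrows_anti[of y k] arrows_le_1[of x k] arrows_le_1[of k y] xk ky by auto
    obtain p p' a where p: "{p, p'} = {u, v}" "a \<noteq> u" "a \<noteq> v" "E x = {a, p}"
      using EM[OF x ne(1)] xk by auto
    obtain q q' b where q: "{q, q'} = {u, v}" "b \<noteq> u" "b \<noteq> v" "E y = {b, q}"
      using EM[OF y ne(2)] ky by auto
    have pk: "p \<in> E k" "q \<in> E k" using p q Ek by auto
    have "a \<noteq> b"
    proof
      assume "a = b"
      then have "p = q" using no_long_cycle[of k x y p q a] k x y ne p q pk by auto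
      then have "a = p" using shared_unique[of x y a p] x y \<open>x \<noteq> y\<close> p q \<open>a = b\<close> by auto
      then show False using p by auto
    qed
    have "q = u \<or> q = v" using q by (auto simp: doubleton_eq_iff)
    then have \<tau>q: "\<tau> q \<noteq> q" "\<tau> q = u \<or> \<tau> q = v" using \<tau>uv uv by metis+
    have "p = u \<or> p = v" using p by (auto simp: doubleton_eq_iff)
    then have ap: "a \<noteq> p" "a \<noteq> q" "b \<noteq> p" "b \<noteq> q" "a \<noteq> \<tau> q" "b \<noteq> \<tau> q"
      using p(2,3) q(2,3) \<tau>q(2) \<open>q = u \<or> q = v\<close> by metis+
    have pq: "p = q \<or> p = \<tau> q" using \<open>p = u \<or> p = v\<close> \<open>q = u \<or> q = v\<close> \<tau>uv by metis
    have E'x: "E' x = E x" using z by (simp add: E'_def M_def)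
    have E'y: "E' y = {b, \<tau> q}" using ky y q \<tau>id[of b] by (simp add: E'_def M_def)
    show ?thesis
    proof (cases "p = q")
      case True
      then have meet: "E x \<inter> E y \<noteq> {}" using p q by auto
      have "arrows Q y x > 0"
        using cyclic[of k y x p] k x y \<open>x \<noteq> y\<close> ne p q True pk ky by auto
      then have "arrows Q y x = 1" "arrows Q x y = 0"
        using arrows_le_1[of y x] arrows_anti[of x y] by auto
      moreover have "E' x \<inter> E' y = {}" using E'x E'y p(4) ap \<open>a \<noteq> b\<close> \<tau>q(1) True by simp
      ultimately show ?thesis using ne z meet by (simp add: arrows_mutate)
    next
      case False
      then have dis: "E x \<inter> E y = {}" using p(4) q(4) \<open>a \<noteq> b\<close> ap by simp
      then have "arrows Q x y = 0" "arrows Q y x = 0" using adjacent_iff[of x y] x y \<open>x \<noteq> y\<close> by auto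
      moreover have "E' x \<inter> E' y \<noteq> {}" using E'x E'y p(4) pq False by simp
      ultimately show ?thesis using ne z dis by (simp add: arrows_mutate)
    qed
  qed
  have pair_other:
    "arrows (mutate k Q) x y = arrows Q x y \<and> (E' x \<inter> E' y = {} \<longleftrightarrow> E x \<inter> E y = {})"
    if x: "x \<in> verts Q" and y: "y \<in> verts Q" and ne: "x \<noteq> y" "x \<noteq> k" "y \<noteq> k"
      and no_path: "\<not> (arrows Q x k > 0 \<and> arrows Q k y > 0)" "\<not> (arrows Q y k > 0 \<and> arrows Q k x > 0)"
    for x y
  proof -
    have "arrows Q x k * arrows Q k y = 0" "arrows Q y k * arrows Q k x = 0"
      using no_path by auto
    then have 1: "arrows (mutate k Q) x y = arrows Q x y"
      using ne arrows_anti[of x y] by (auto simp: arrows_mutate)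
    have *: "\<tau> ` E x \<inter> E y = {} \<longleftrightarrow> E x \<inter> E y = {}" if "E y \<inter> {u, v} = {}" for x y
    proof -
      have "\<tau> ` E y = E y"       proof -
        have "\<tau> ` E y = (\<lambda>a. a) ` E y" by (intro image_cong refl \<tau>id) (use that in blast)+
        then show ?thesis by simp
      qed
      then have "\<tau> ` E x \<inter> E y = \<tau> ` (E x \<inter> E y)" using inj by (simp add: image_Int)
      then show ?thesis by simp
    qed
    have "E' x \<inter> E' y = {} \<longleftrightarrow> E x \<inter> E y = {}"
    proof (cases "x \<in> M \<longleftrightarrow> y \<in> M")
      case True
      then show ?thesis by (auto simp: E'_def simp flip: image_Int[OF inj])
    next
      case False
      then consider "x \<in> M" "y \<notin> M" | "y \<in> M" "x \<notin> M" by blast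
      \<comment> \<open>The vertex outside \<open>M\<close> is not adjacent to \<open>k\<close>: an
        arrow from \<open>k\<close> would put it into \<open>M\<close>, and an arrow to
        \<open>k\<close> would complete one of the excluded paths.\<close>
      then consider "x \<in> M" "y \<notin> M" "E y \<inter> {u, v} = {}" | "y \<in> M" "x \<notin> M" "E x \<inter> {u, v} = {}"
        using nonadj[of x] nonadj[of y] no_path x y ne by cases (auto simp: M_def)
      then show ?thesis using *[of y x] *[of x y] by cases (auto simp: E'_def Int_commute)
    qed
    then show ?thesis using 1 by simp
  qed
  have at_uv: "\<exists>p\<in>E k. p \<in> E x \<and> (x \<in> M \<and> p = \<tau> w \<or> x \<notin> M \<and> arrows Q x k > 0 \<and> p = w)"
    if x: "x \<in> verts Q" "x \<noteq> k" and w: "w \<in> E' x" "w \<in> {u, v}" for x w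
  proof (cases "x \<in> M")
    case True
    then obtain c where "w = \<tau> c" "c \<in> E x" using w by (auto simp: E'_def)
    moreover have "\<tau> w \<in> E k" using w \<tau>uv Ek by auto
    ultimately show ?thesis using True \<tau>\<tau> by auto
  next
    case False
    then have "w \<in> E x" "w \<in> E k" using w Ek by (auto simp: E'_def)
    moreover then have "arrows Q x k > 0" using adjacent_iff[of x k] x k False by (auto simp: M_def)
    ultimately show ?thesis using False by auto
  qed
  \<comment> \<open>Two moved edges, or two unmoved ones, with a common end \<open>w\<close> after
    the slide had a common end on \<open>k\<close> before it, and their arrows both left
    \<open>k\<close> or both entered \<open>k\<close>. This contradicts the cyclic orientation of
    the triangle at that end.\<close>
  have two_uv: "x \<in> M \<longleftrightarrow> y \<notin> M"
    if x: "x \<in> verts Q" "x \<noteq> k" and y: "y \<in> verts Q" "y \<noteq> k" and "x \<noteq> y"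
      and w: "w \<in> E' x" "w \<in> E' y" "w \<in> {u, v}" for x y w
  proof (rule ccontr)
    assume "\<not> ?thesis"
    then obtain p where p: "p \<in> E k" "p \<in> E x" "p \<in> E y"
      and *: "arrows Q k x > 0 \<and> arrows Q k y > 0 \<or> arrows Q x k > 0 \<and> arrows Q y k > 0"
      using at_uv[OF x w(1,3)] at_uv[OF y w(2,3)] by (auto simp: M_def)
    show False
      using * cyclic[of x k y p] cyclic[of k x y p] cyclic[of x y k p] arrows_anti[of x k] arrows_anti[of y k]
        x y k \<open>x \<noteq> y\<close> p by auto
  qed
  \<comment> \<open>If both touched \<open>k\<close>, then \<open>x\<close>, \<open>y\<close> and
    \<open>k\<close> would close a cycle or force \<open>w\<close> to be an end of \<open>k\<close>.
    Hence arrows around a vertex off \<open>k\<close> are unchanged.\<close>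
  have away: "\<not> (arrows Q x k > 0 \<and> arrows Q k y > 0)"
    if x: "x \<in> verts Q" "x \<noteq> k" and y: "y \<in> verts Q" "y \<noteq> k" and "x \<noteq> y"
      and w: "w \<in> E x" "w \<in> E y" "w \<notin> {u, v}" for x y w
  proof
    assume *: "arrows Q x k > 0 \<and> arrows Q k y > 0"
    obtain p where p: "p \<in> E x" "p \<in> E k" using adjacent_iff[of x k] * x k by auto
    obtain q where q: "q \<in> E y" "q \<in> E k" using adjacent_iff[of y k] * y k by auto
    have "p = q" using no_long_cycle[of k x y p q w] k x y p q w by auto
    then have "w = p" using shared_unique[of x y w p] x y \<open>x \<noteq> y\<close> p q w by auto
    then show False using p w Ek by auto
  qed
  have \<tau>_mem: "\<tau> c \<in> A \<longleftrightarrow> c \<in> A" if "u \<in> A \<longleftrightarrow> v \<in> A" for c A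
    using that \<tau>id[of c] \<tau>uv by (cases "c = u"; cases "c = v") auto
  \<comment> \<open>Only the cut of \<open>k\<close> separates \<open>u\<close> from
    \<open>v\<close>, so all other cuts are unaffected by the swap \<tau> and stay valid for the
    moved edges.\<close>
  have \<tau>_cut: "\<tau> c \<in> C x \<longleftrightarrow> c \<in> C x" if "x \<in> verts Q" "x \<noteq> k" for x c
    using \<tau>_mem cut_same[of x k u v] that k Ek by auto
  have E'_image: "\<exists>h. E' y = h ` E y \<and> (h = \<tau> \<or> h = (\<lambda>c. c))" for y
    by (cases "y \<in> M") (auto simp: E'_def)
  have MV: "x \<in> verts Q" if "x \<in> M" for x using that by (simp add: M_def)
  have "tree_quiver (mutate k Q) E' C'"
  proof
    show "finite (verts (mutate k Q))" using fin by (simp add: mutate_def)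
  next
    fix x y
    assume "arrows (mutate k Q) x y > 0"
    then have "arrows Q y x > 0 \<or> arrows Q x y > 0 \<or> arrows Q x k > 0 \<and> arrows Q k y > 0"
      by (cases "arrows Q x k"; cases "arrows Q k y") (auto simp: arrows_mutate split: if_splits)
    then show "x \<in> verts (mutate k Q) \<and> y \<in> verts (mutate k Q)"
      using arrows_verts[of x y] arrows_verts[of y x] arrows_verts[of x k] arrows_verts[of k y]
      by (auto simp: mutate_def)
  next
    fix x y
    show "arrows (mutate k Q) x y = 0 \<or> arrows (mutate k Q) y x = 0"
      using arrows_anti[of x y] by (auto simp: arrows_mutate)
  next
    fix x assume "x \<in> verts (mutate k Q)"
    then show "card (E' x) = 2"
      using card_E[of x] inj by (auto simp: mutate_def E'_def card_image inj_on_subset)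
  next
    fix x y
    assume xy: "x \<in> verts (mutate k Q)" "y \<in> verts (mutate k Q)" "x \<noteq> y"
    then have x: "x \<in> verts Q" and y: "y \<in> verts Q" by (auto simp: mutate_def)
    have *: "E' x \<inter> E' k = {} \<longleftrightarrow> E x \<inter> E k = {}" for x
    proof -
      have "\<tau> ` E x \<inter> \<tau> ` E k = \<tau> ` (E x \<inter> E k)" using inj by (simp add: image_Int)
      moreover have "\<tau> ` E k = E k" using Ek \<tau>uv by auto
      ultimately show ?thesis using kM by (auto simp: E'_def)
    qed
    show "edges (mutate k Q) x y = (if E' x \<inter> E' y = {} then 0 else 1)"
    proof (cases "x = k \<or> y = k")
      case True
      then have "edges (mutate k Q) x y = edges Q x y" by (auto simp: edges_def arrows_mutate)
      moreover have "E' x \<inter> E' y = {} \<longleftrightarrow> E x \<inter> E y = {}"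
        using True *[of x] *[of y] by (metis Int_commute)
      ultimately show ?thesis using edges_eq[OF x y xy(3)] by simp
    next
      case False
      consider "arrows Q x k > 0" "arrows Q k y > 0" | "arrows Q y k > 0" "arrows Q k x > 0" |
        "\<not> (arrows Q x k > 0 \<and> arrows Q k y > 0)" "\<not> (arrows Q y k > 0 \<and> arrows Q k x > 0)" by argo
      then show ?thesis
      proof cases
        case 1
        then show ?thesis using pair_out_in[OF x y xy(3)] by (simp add: edges_def)
      next
        case 2
        then show ?thesis using pair_out_in[OF y x] xy(3) by (simp add: edges_def Int_commute)
      next
        case 3
        then show ?thesis using pair_other[of x y] pair_other[of y x] x y xy(3) False edges_eq[OF x y xy(3)]
          by (simp add: edges_def Int_commute)
      qed
    qed
  next
    fix x y z w
    assume V: "x \<in> verts (mutate k Q)" "y \<in> verts (mutate k Q)" "z \<in> verts (mutate k Q)"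
      and d: "distinct [x, y, z]" and w: "w \<in> E' x" "w \<in> E' y" "w \<in> E' z"
      and a: "arrows (mutate k Q) x y > 0"
    then have x: "x \<in> verts Q" and y: "y \<in> verts Q" and z: "z \<in> verts Q" by (auto simp: mutate_def)
    show "arrows (mutate k Q) y z > 0"
    proof (cases "w \<in> {u, v}")
      case False
      then have w': "w \<in> E i" if "w \<in> E' i" for i
      proof (cases "i \<in> M")
        case True
        then have "w \<in> \<tau> ` E i" using that by (simp add: E'_def)
        then obtain c where "w = \<tau> c" "c \<in> E i" by blast
        then show ?thesis using False \<tau>id[of c] \<tau>uv by (cases "c = u"; cases "c = v") auto
      qed (use that in \<open>simp add: E'_def\<close>)
      have k: "x \<noteq> k" "y \<noteq> k" "z \<noteq> k" using w E'k False by auto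
      have ww: "w \<in> E x" "w \<in> E y" "w \<in> E z" using w' w by auto
      have d': "x \<noteq> y" "y \<noteq> x" "y \<noteq> z" "z \<noteq> y" using d by auto
      have "arrows (mutate k Q) x y = arrows Q x y"
        using pair_other[OF x y d'(1) k(1,2) away[OF x k(1) y k(2) d'(1) ww(1,2) False]
            away[OF y k(2) x k(1) d'(2) ww(2,1) False]] by blast
      moreover have "arrows (mutate k Q) y z = arrows Q y z"
        using pair_other[OF y z d'(3) k(2,3) away[OF y k(2) z k(3) d'(3) ww(2,3) False]
            away[OF z k(3) y k(2) d'(4) ww(3,2) False]] by blast
      ultimately show ?thesis using cyclic[OF x y z d] w' w a by auto
    next
      case True
      have arr: "arrows Q i k > 0" if "i \<in> verts Q" "i \<noteq> k" "i \<notin> M" "w \<in> E' i" for i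
        using at_uv[OF that(1,2,4) True] that by auto
      have ki: "i \<in> verts Q \<and> arrows Q k i > 0" if "i \<in> M" for i using that by (simp add: M_def)
      \<comment> \<open>With the reversed arrows at \<open>k\<close> this gives the new orientation
        at \<open>w\<close>: from \<open>k\<close> to the unmoved edge, from there to the moved
        edge, and back to \<open>k\<close>.\<close>
      have pair: "arrows (mutate k Q) i j > 0 \<and> arrows (mutate k Q) j i = 0"
        if "i \<in> verts Q" "i \<noteq> k" "i \<notin> M" "w \<in> E' i" "j \<in> M" "w \<in> E' j" for i j
      proof -
        have "E' i \<inter> E' j \<noteq> {}" "i \<noteq> j" using that by auto
        then show ?thesis using pair_out_in[of i j] arr[of i] ki[of j] that by auto
      qed
      consider "x = k" | "y = k" | "z = k" | "x \<noteq> k" "y \<noteq> k" "z \<noteq> k" by blast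
      then show ?thesis
      proof cases
        case 1
        then have "arrows Q y k > 0" using a by (simp add: arrows_mutate)
        then have "y \<notin> M" using arrows_anti[of y k] by (auto simp: M_def)
        then have "z \<in> M" using two_uv[of y z w] 1 d y z w True by auto
        then show ?thesis using pair[of y z] y z w \<open>y \<notin> M\<close> 1 d by auto
      next
        case 2
        then have "x \<in> M" using a x by (simp add: arrows_mutate M_def)
        then have "z \<notin> M" using two_uv[of x z w] 2 d x z w True by auto
        then show ?thesis using arr[of z] 2 z w d \<open>z \<notin> M\<close> by (auto simp add: arrows_mutate)
      next
        case 3
        have "y \<in> M"
        proof (rule ccontr)
          assume "y \<notin> M"
          then have "x \<in> M" using two_uv[of x y w] 3 d x y w True by auto
          then show False using pair[of y x] \<open>y \<notin> M\<close> y w 3 d a by auto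
        qed
        then show ?thesis using 3 ki[of y] by (simp add: arrows_mutate)
      next
        case 4
        \<comment> \<open>Pigeonhole: of three edges other than \<open>k\<close>, two are both moved
          or both unmoved.\<close>
        then have False using two_uv[of x y w] two_uv[of x z w] two_uv[of y z w] d x y z w True by auto
        then show ?thesis ..
      qed
    qed
  next
    fix x y a b
    assume V: "x \<in> verts (mutate k Q)" "y \<in> verts (mutate k Q)" and "x \<noteq> y"
      and ab: "a \<in> E' y" "b \<in> E' y"
    then have x: "x \<in> verts Q" and y: "y \<in> verts Q" by (auto simp: mutate_def)
    show "a \<in> C' x \<longleftrightarrow> b \<in> C' x"
    proof (cases "x = k")
      case False
      obtain h where h: "E' y = h ` E y" "h = \<tau> \<or> h = (\<lambda>c. c)" using E'_image by blast
      then obtain a' b' where "a = h a'" "b = h b'" "a' \<in> E y" "b' \<in> E y" using ab by auto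
      moreover have "h c \<in> C x \<longleftrightarrow> c \<in> C x" for c using h(2) \<tau>_cut[OF x False] by auto
      ultimately show ?thesis
        using cut_same[OF x y \<open>x \<noteq> y\<close>, of a' b'] False by (simp add: C'_def)
    next
      case [simp]: True
      show ?thesis
      proof (cases "a = b")
        case ne: False
        have "even (card {z \<in> insert k M. (a \<in> C z) \<noteq> (b \<in> C z)})"
        proof (cases "y \<in> M")
          case False
          have "a \<in> C z \<longleftrightarrow> b \<in> C z" if "z \<in> insert k M" for z
            using False cut_same[of z y a b] that ab y k MV \<open>x \<noteq> y\<close> by (auto simp: E'_def)
          then have none: "{z \<in> insert k M. (a \<in> C z) \<noteq> (b \<in> C z)} = {}" by blast
          show ?thesis unfolding none by simp
        next
          case yM: True
          obtain p p' c where p: "{p, p'} = {u, v}" "c \<noteq> u" "c \<noteq> v" "E y = {c, p}"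
            using EM[OF y] \<open>x \<noteq> y\<close> yM by (auto simp: M_def)
          have "E' y = {c, \<tau> p}" using p yM \<tau>id[of c] by (auto simp: E'_def)
          then have sep: "(a \<in> C z) \<noteq> (b \<in> C z) \<longleftrightarrow> (c \<in> C z) \<noteq> (\<tau> p \<in> C z)" for z
            using ab ne by auto
          \<comment> \<open>The slid edge joins \<open>c\<close> to \<open>\<tau> p\<close>. Among
            the cuts counted, exactly those of \<open>k\<close> (separating \<open>p\<close> from
            \<open>\<tau> p\<close>) and of \<open>y\<close> (separating \<open>c\<close> from
            \<open>p\<close>) separate these ends, an even number.\<close>
          have "(c \<in> C k) \<noteq> (\<tau> p \<in> C k)"
            using cut_same[of k y c p] cut_diff[of k u v] k y \<open>x \<noteq> y\<close> p uv \<tau>uv Ek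
            by (auto simp: doubleton_eq_iff)
          moreover have "(c \<in> C z) \<noteq> (\<tau> p \<in> C z) \<longleftrightarrow> z = y" if "z \<in> M" for z
            using \<tau>_cut[of z p] cut_same[of z y c p] cut_diff[of y c p] that MV[OF that] kM y p
            by (auto simp: doubleton_eq_iff)
          ultimately have "{z \<in> insert k M. (a \<in> C z) \<noteq> (b \<in> C z)} = {k, y}"
            using yM unfolding sep by auto
          then show ?thesis using \<open>x \<noteq> y\<close> by simp
        qed
        then show ?thesis
          using odd_card_neq_iff[of "insert k M" "\<lambda>z. a \<in> C z" "\<lambda>z. b \<in> C z"] finM by (auto simp: C'_def)
      qed simp
    qed
  next
    fix x a b
    assume "x \<in> verts (mutate k Q)" and ab: "a \<in> E' x" "b \<in> E' x" "a \<noteq> b"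
    then have x: "x \<in> verts Q" by (simp add: mutate_def)
    show "a \<in> C' x \<longleftrightarrow> b \<notin> C' x"
    proof (cases "x = k")
      case False
      obtain h where h: "E' x = h ` E x" "h = \<tau> \<or> h = (\<lambda>c. c)" using E'_image by blast
      then obtain a' b' where "a = h a'" "b = h b'" "a' \<in> E x" "b' \<in> E x" using ab by auto
      moreover have "h c \<in> C x \<longleftrightarrow> c \<in> C x" for c using h(2) \<tau>_cut[OF x False] by auto
      ultimately show ?thesis
        using cut_diff[OF x, of a' b'] False ab(3) by (auto simp: C'_def)
    next
      case [simp]: True
      have "{z \<in> insert k M. (a \<in> C z) \<noteq> (b \<in> C z)} = {k}"
        using cut_same[of _ k a b] cut_diff[of k a b] ab E'k Ek k MV kM by auto
      then show ?thesis
        using odd_card_neq_iff[of "insert k M" "\<lambda>z. a \<in> C z" "\<lambda>z. b \<in> C z"] finM by (auto simp: C'_def)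
    qed
  next
    fix A x y
    assume A: "\<And>y. y \<in> verts (mutate k Q) \<Longrightarrow> E' y \<subseteq> A \<or> E' y \<inter> A = {}"
      and x: "x \<in> verts (mutate k Q)" "E' x \<subseteq> A" and y: "y \<in> verts (mutate k Q)"
    \<comment> \<open>A set not crossed by \<open>k\<close> contains both or neither of
      \<open>u\<close>, \<open>v\<close>, so it is invariant under \<tau> and is crossed by a slid
      edge iff it was crossed by the original one.\<close>
    have "u \<in> A \<longleftrightarrow> v \<in> A" using A[of k] k E'k by (auto simp: mutate_def)
    then have \<tau>A: "\<tau> c \<in> A \<longleftrightarrow> c \<in> A" for c using \<tau>_mem by blast
    have sub: "E' z \<subseteq> A \<longleftrightarrow> E z \<subseteq> A" "E' z \<inter> A = {} \<longleftrightarrow> E z \<inter> A = {}" for z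
      using \<tau>A by (auto simp: E'_def)
    show "E' y \<subseteq> A"
      unfolding sub by (rule conn[of A x]) (use A x y in \<open>auto simp: mutate_def sub\<close>)
  qed
  then show ?thesis by blast
qed

end

lemma mutation_type_A_tree_quiver:
  "mutation_type_A n Q \<Longrightarrow> card (verts Q) = n \<and> (\<exists>E C. tree_quiver Q E C)"
proof (induction rule: mutation_type_A.induct)
  case (base Q)
  then show ?case by (rule tree_quiver_line)
next
  case (mutation Q k)
  then obtain E C where "tree_quiver Q E C" by blast
  then show ?case using mutation tree_quiver.mutate_tree_quiver[of Q E C k] by (auto simp: mutate_def)
qed


section \<open>Branches and rooted subquivers\<close>

lemma verts_full_subquiver [simp]: "verts (full_subquiver Q S) = S"
  by (simp add: full_subquiver_def)

lemma three_cycle_full_subquiver: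
  "three_cycle (full_subquiver Q S) x y z \<longleftrightarrow> three_cycle Q x y z \<and> x \<in> S \<and> y \<in> S \<and> z \<in> S"
  by (auto simp: three_cycle_def full_subquiver_def)

text \<open>A leaf \<open>c\<close> of the tree together with its only edge \<open>f\<close>. The
  leaf is recorded because a tree with one edge offers two choices.\<close>

definition free_end :: "'v quiver \<Rightarrow> ('v \<Rightarrow> nat set) \<Rightarrow> 'v \<Rightarrow> nat \<Rightarrow> bool" where
  "free_end Q E f c \<longleftrightarrow> f \<in> verts Q \<and> c \<in> E f \<and> (\<forall>y\<in>verts Q. c \<in> E y \<longrightarrow> y = f)"

context tree_quiver
begin

lemma valency_eq_card:
  assumes "x \<in> verts Q"
  shows "valency Q x = card {y \<in> verts Q. y \<noteq> x \<and> E x \<inter> E y \<noteq> {}}"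
proof -
  have "valency Q x = (\<Sum>y\<in>verts Q. if y \<noteq> x \<and> E x \<inter> E y \<noteq> {} then 1 else 0)"
    unfolding valency_def
  proof (rule sum.cong)
    fix y assume "y \<in> verts Q"
    then show "edges Q x y = (if y \<noteq> x \<and> E x \<inter> E y \<noteq> {} then 1 else 0)"
      using edges_eq[of x y] assms by (cases "x = y") (auto simp: edges_def)
  qed simp
  then show ?thesis by (simp add: sum.If_cases[OF fin] Int_def)
qed

text \<open>If both ends of \<open>x\<close> carried further edges, these would be two neighbours,
  so the valency would be 2 with \<open>x\<close> on a 3-cycle. But the other two edges of that
  3-cycle meet \<open>x\<close> at the same end.\<close>

lemma end_vertex_free_end:
  assumes "end_vertex Q x"
  obtains c where "free_end Q E x c"
proof -
  define N where "N = {y \<in> verts Q. y \<noteq> x \<and> E x \<inter> E y \<noteq> {}}"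
  have x: "x \<in> verts Q" using assms by (simp add: end_vertex_def)
  obtain a b where ab: "E x = {a, b}" "a \<noteq> b" using card_E[OF x] by (auto simp: card_2_iff)
  have "\<exists>c. free_end Q E x c"
  proof (rule ccontr)
    assume "\<not> ?thesis"
    then have "\<not> free_end Q E x a" "\<not> free_end Q E x b" by auto
    then obtain y z where y: "y \<in> verts Q" "y \<noteq> x" "a \<in> E y" and z: "z \<in> verts Q" "z \<noteq> x" "b \<in> E z"
      using x ab unfolding free_end_def by blast
    have yz: "y \<noteq> z" using shared_unique[of x y a b] x y z ab by auto
    have "{y, z} \<subseteq> N" using y z ab by (auto simp: N_def)
    moreover have finN: "finite N" using fin by (simp add: N_def)
    ultimately have "card N \<ge> 2" using card_mono[of N "{y, z}"] yz by simp
    then have N2: "card N = 2" and "\<exists>y z. three_cycle Q x y z"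
      using assms valency_eq_card[OF x] by (auto simp: end_vertex_def N_def)
    then obtain y' z' w where t: "y' \<in> verts Q" "z' \<in> verts Q" "distinct [x, y', z']"
        "w \<in> E x" "w \<in> E y'" "w \<in> E z'"
      by (auto simp: three_cycle_iff)
    have "N = {y, z}" using card_subset_eq[OF finN \<open>{y, z} \<subseteq> N\<close>] N2 yz by simp
    moreover have "y' \<in> N" "z' \<in> N" "y' \<noteq> z'" using t by (auto simp: N_def)
    ultimately have "w \<in> E y" "w \<in> E z" using t by auto
    then show False
      using shared_unique[of x y a b] shared_unique[of x z a b] x y z ab t(4) by auto
  qed
  then show ?thesis using that by blast
qed

text \<open>From \<open>x -> y\<close> the cyclic rule yields \<open>y -> z\<close> and
  \<open>y -> u\<close>, and then both \<open>z -> u\<close> and \<open>u -> z\<close>, a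
  2-cycle.\<close>

lemma at_most_three:
  assumes "x \<in> verts Q" "y \<in> verts Q" "z \<in> verts Q" "u \<in> verts Q"
    and "w \<in> E x" "w \<in> E y" "w \<in> E z" "w \<in> E u" and "distinct [x, y, z]"
  shows "u \<in> {x, y, z}"
proof (rule ccontr)
  assume "u \<notin> {x, y, z}"
  have *: False
    if "arrows Q x y > 0" "x \<in> verts Q" "y \<in> verts Q" "w \<in> E x" "w \<in> E y" "x \<noteq> y"
      "x \<noteq> z" "y \<noteq> z" "u \<noteq> x" "u \<noteq> y" "u \<noteq> z" for x y
  proof -
    have "arrows Q y z > 0" "arrows Q y u > 0"
      using cyclic[of x y z w] cyclic[of x y u w] that assms by auto
    then have "arrows Q z u > 0" "arrows Q u z > 0"
      using cyclic[of y z u w] cyclic[of y u z w] that assms by auto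
    then show False using arrows_anti[of z u] by simp
  qed
  show False
    using *[of x y] *[of y x] adjacent_iff[of x y] assms \<open>u \<notin> {x, y, z}\<close> by auto
qed

text \<open>For an end \<open>w\<close> of the tree edge \<open>z\<close>, \<open>side z w\<close> is the side of \<open>z\<close> not containing \<open>w\<close>.\<close>

definition side :: "'v \<Rightarrow> nat \<Rightarrow> nat set" where
  "side z w = {a. a \<in> C z \<longleftrightarrow> w \<notin> C z}"

text \<open>The edge \<open>z\<close> is added explicitly, since its end \<open>w\<close> lies
  outside the side.\<close>

definition branch :: "'v \<Rightarrow> nat \<Rightarrow> 'v set" where
  "branch z w = {v \<in> verts Q. v = z \<or> E v \<subseteq> side z w}"

lemma side_cases:
  assumes "z \<in> verts Q" "v \<in> verts Q" "v \<noteq> z"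
  shows "E v \<subseteq> side z w \<or> E v \<inter> side z w = {}"
  using assms cut_same[of z v] unfolding side_def by blast

lemma notin_side [simp]: "w \<notin> side z w"
  by (simp add: side_def)

lemma other_end_in_side:
  assumes "z \<in> verts Q" "w \<in> E z" "a \<in> E z" "a \<noteq> w"
  shows "a \<in> side z w"
  using assms cut_diff[of z a w] by (simp add: side_def)

lemma branch_subset: "branch z w \<subseteq> verts Q"
  by (auto simp: branch_def)

lemma root_in_branch: "z \<in> verts Q \<Longrightarrow> z \<in> branch z w"
  by (auto simp: branch_def)

lemma branchI:
  assumes "z \<in> verts Q" "v \<in> verts Q" "a \<in> E v" "a \<in> side z w"
  shows "v \<in> branch z w"
  using assms side_cases[of z v w] by (auto simp: branch_def)

lemma branchD:
  assumes "z \<in> verts Q" "w \<in> E z" "v \<in> branch z w" "a \<in> E v" "a \<noteq> w"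
  shows "a \<in> side z w"
  using assms other_end_in_side[of z w a] by (auto simp: branch_def)

lemma free_end_branch:
  "z \<in> verts Q \<Longrightarrow> w \<in> E z \<Longrightarrow> free_end (full_subquiver Q (branch z w)) E z w"
  by (auto simp: free_end_def full_subquiver_def branch_def subset_iff)

lemma tree_quiver_branch:
  assumes z: "z \<in> verts Q" and w: "w \<in> E z"
  shows "tree_quiver (full_subquiver Q (branch z w)) E C"
proof -
  have V: "x \<in> verts Q" if "x \<in> branch z w" for x using that branch_subset by blast
  show ?thesis
  proof
    fix A x y
    assume A: "\<And>y. y \<in> verts (full_subquiver Q (branch z w)) \<Longrightarrow> E y \<subseteq> A \<or> E y \<inter> A = {}"
      and x: "x \<in> verts (full_subquiver Q (branch z w))" "E x \<subseteq> A"
      and y: "y \<in> verts (full_subquiver Q (branch z w))"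
    \<comment> \<open>The branch meets the rest of the tree only at \<open>w\<close>. So a set
      closed within the branch extends to a closed set of the whole tree by taking all or nothing
      beyond the side, according to whether it contains \<open>w\<close>.\<close>
    define A' where "A' = (A \<inter> side z w) \<union> (if w \<in> A then - side z w else {})"
    have eq: "a \<in> A' \<longleftrightarrow> a \<in> A" if "v \<in> branch z w" "a \<in> E v" for v a
      using branchD[OF z w that] by (cases "a = w") (auto simp: A'_def)
    have "E v \<subseteq> A' \<or> E v \<inter> A' = {}" if "v \<in> verts Q" for v
    proof (cases "v \<in> branch z w")
      case True
      then have "E v \<subseteq> A \<or> E v \<inter> A = {}" using A[of v] by (simp add: full_subquiver_def)
      then show ?thesis using eq[OF True] by blast
    next
      case False
      then have "E v \<inter> side z w = {}" using side_cases[OF z that, of w] that by (auto simp: branch_def)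
      then show ?thesis by (auto simp: A'_def)
    qed
    moreover have "E x \<subseteq> A'" using x eq[of x] by (auto simp: full_subquiver_def)
    ultimately have "E y \<subseteq> A'" using conn[of A' x y] x y V by (simp add: full_subquiver_def)
    then show "E y \<subseteq> A" using y eq[of y] by (auto simp: full_subquiver_def)
  next
    show "finite (verts (full_subquiver Q (branch z w)))"
      using fin branch_subset by (auto simp: full_subquiver_def intro: finite_subset)
  next
    fix x y z' w'
    assume "x \<in> verts (full_subquiver Q (branch z w))" "y \<in> verts (full_subquiver Q (branch z w))"
      "z' \<in> verts (full_subquiver Q (branch z w))" "distinct [x, y, z']" "w' \<in> E x" "w' \<in> E y" "w' \<in> E z'"
      "arrows (full_subquiver Q (branch z w)) x y > 0"
    then show "arrows (full_subquiver Q (branch z w)) y z' > 0"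
      using cyclic[of x y z' w'] V by (simp add: full_subquiver_def)
  next
    fix x y a b
    assume "x \<in> verts (full_subquiver Q (branch z w))" "y \<in> verts (full_subquiver Q (branch z w))"
      "x \<noteq> y" "a \<in> E y" "b \<in> E y"
    then show "a \<in> C x \<longleftrightarrow> b \<in> C x"
      using cut_same[of x y a b] V by (simp add: full_subquiver_def)
  next
    fix x y
    assume "x \<in> verts (full_subquiver Q (branch z w))" "y \<in> verts (full_subquiver Q (branch z w))" "x \<noteq> y"
    then show "edges (full_subquiver Q (branch z w)) x y = (if E x \<inter> E y = {} then 0 else 1)"
      using edges_eq[of x y] V by (simp add: full_subquiver_def edges_def)
  next
    fix x y
    show "arrows (full_subquiver Q (branch z w)) x y = 0 \<or> arrows (full_subquiver Q (branch z w)) y x = 0"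
      using arrows_anti[of x y] by (auto simp: full_subquiver_def)
  next
    fix x a b
    assume "x \<in> verts (full_subquiver Q (branch z w))" "a \<in> E x" "b \<in> E x" "a \<noteq> b"
    then show "a \<in> C x \<longleftrightarrow> b \<notin> C x"
      using cut_diff[of x a b] V by (simp add: full_subquiver_def)
  next
    fix x
    assume "x \<in> verts (full_subquiver Q (branch z w))"
    then show "card (E x) = 2"
      using card_E V by (simp add: full_subquiver_def)
  qed (auto simp: full_subquiver_def split: if_splits)
qed

text \<open>No edge of the branch crosses the boundary of the set of ends of the edges reachable
  from \<open>z\<close>, so connectedness of the branch shows that everything is reached.\<close>

lemma branch_walk:
  assumes z: "z \<in> verts Q" and w: "w \<in> E z" and v: "v \<in> branch z w"
  shows "(z, v) \<in> {(a, b). a \<in> branch z w \<and> b \<in> branch z w \<and> edges Q a b > 0}\<^sup>*" (is "_ \<in> ?R\<^sup>*")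
proof -
  interpret B: tree_quiver "full_subquiver Q (branch z w)" E C
    by (rule tree_quiver_branch[OF z w])
  have [simp]: "verts (full_subquiver Q (branch z w)) = branch z w" by (simp add: full_subquiver_def)
  define S where "S = {v. (z, v) \<in> ?R\<^sup>*}"
  have SB: "S \<subseteq> branch z w"
  proof
    fix v assume "v \<in> S"
    then have "(z, v) \<in> ?R\<^sup>*" by (simp add: S_def)
    then show "v \<in> branch z w" by cases (use z in \<open>auto simp: root_in_branch\<close>)
  qed
  have step: "v \<in> S" if "u \<in> S" "v \<in> branch z w" "a \<in> E u" "a \<in> E v" for u v a
  proof (cases "u = v")
    case False
    have "u \<in> branch z w" using that SB by blast
    moreover then have "u \<in> verts Q" "v \<in> verts Q" using that branch_subset by blast+
    then have "edges Q u v > 0" using edges_eq[of u v] False that by auto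
    ultimately have "(u, v) \<in> ?R" using that by auto
    then show ?thesis using that(1) unfolding S_def by (auto intro: rtrancl_into_rtrancl)
  qed (use that in simp)
  define A where "A = (\<Union>v\<in>S. E v)"
  have "E v \<subseteq> A"
  proof (rule B.conn[of A z v])
    fix y assume "y \<in> verts (full_subquiver Q (branch z w))"
    then show "E y \<subseteq> A \<or> E y \<inter> A = {}" using step[of _ y] by (auto simp: A_def)
  qed (use z v in \<open>auto simp: root_in_branch A_def S_def\<close>)
  moreover have "E v \<noteq> {}" using card_E[of v] v branch_subset by fastforce
  ultimately obtain a u where "a \<in> E v" "u \<in> S" "a \<in> E u" unfolding A_def by blast
  then have "v \<in> S" using step[of u v a] v by blast
  then show ?thesis by (simp add: S_def)
qed

text \<open>A shortest walk inside a branch is a string.\<close>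

lemma branch_string:
  assumes z: "z \<in> verts Q" and w: "w \<in> E z" and v: "v \<in> branch z w"
  obtains p where "string_from_to Q p z v" "set p \<subseteq> branch z w"
proof -
  define R where "R = {(a, b). a \<in> branch z w \<and> b \<in> branch z w \<and> edges Q a b > 0}"
  define n where "n = (LEAST n. (z, v) \<in> R ^^ n)"
  have "\<exists>n. (z, v) \<in> R ^^ n" using branch_walk[OF z w v] by (auto simp: R_def rtrancl_power)
  then have n: "(z, v) \<in> R ^^ n" unfolding n_def by (rule LeastI_ex)
  have least: "n \<le> n'" if "(z, v) \<in> R ^^ n'" for n' using that unfolding n_def by (rule Least_le)
  obtain g where g: "g 0 = z" "g n = v" "\<And>i. i < n \<Longrightarrow> (g i, g (Suc i)) \<in> R"
    using n unfolding relpow_fun_conv by blast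
  have sub: "(g i, g (i + j)) \<in> R ^^ j" if "i + j \<le> n" for i j
    unfolding relpow_fun_conv using g(3) that by (intro exI[of _ "\<lambda>l. g (i + l)"]) auto
  \<comment> \<open>A return to the same vertex or a chord of a 3-cycle would replace two steps by
    \<open>i < 2\<close> steps.\<close>
  have short: "\<not> (g k = g (k + 2) \<or> (g k, g (k + 2)) \<in> R)" if k: "k + 2 \<le> n" for k
  proof
    assume *: "g k = g (k + 2) \<or> (g k, g (k + 2)) \<in> R"
    then obtain i where i: "i < 2" "(g k, g (k + 2)) \<in> R ^^ i"
    proof
      assume "g k = g (k + 2)"
      then show ?thesis using that[of 0] by simp
    next
      assume "(g k, g (k + 2)) \<in> R"
      then show ?thesis using that[of 1] by simp
    qed
    have "k + 2 + (n - k - 2) = n" using k by simp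
    then have "(g (k + 2), v) \<in> R ^^ (n - k - 2)" using sub[of "k + 2" "n - k - 2"] g(2) by (metis order_refl)
    moreover have "(z, g k) \<in> R ^^ k" using sub[of 0 k] g k by simp
    ultimately have "(z, v) \<in> R ^^ (k + (i + (n - k - 2)))"
      using i(2) unfolding relpow_add by blast
    then show False using least[of "k + (i + (n - k - 2))"] i(1) k by simp
  qed
  have inB: "g i \<in> branch z w" if "i \<le> n" for i
  proof (cases i)
    case 0
    then show ?thesis using g(1) z root_in_branch by simp
  next
    case (Suc j)
    then show ?thesis using g(3)[of j] that by (simp add: R_def)
  qed
  define p where "p = map g [0..<Suc n]"
  have len: "length p = Suc n" and nth: "\<And>i. i \<le> n \<Longrightarrow> p ! i = g i"
    by (auto simp: p_def nth_append simp del: upt_Suc)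
  have "string_from_to Q p z v"
    unfolding string_from_to_def
  proof (intro conjI allI impI)
    show "p \<noteq> []" using len by auto
    show "hd p = z" using nth[of 0] g(1) len by (simp add: hd_conv_nth \<open>p \<noteq> []\<close>)
    show "last p = v" using nth[of n] g(2) len by (simp add: last_conv_nth \<open>p \<noteq> []\<close>)
    have "g i \<in> verts Q" if "i \<le> n" for i using inB[OF that] branch_subset by blast
    then show "set p \<subseteq> verts Q" by (auto simp: p_def)
  next
    fix k assume "k + 1 < length p"
    then show "edges Q (p ! k) (p ! (k + 1)) > 0" using nth g(3)[of k] len by (simp add: R_def)
  next
    fix k assume "k + 2 < length p"
    then show "p ! k \<noteq> p ! (k + 2)" "\<not> three_cycle Q (p ! k) (p ! (k + 1)) (p ! (k + 2))"
      using short[of k] nth[of k] nth[of "k + 2"] inB[of k] inB[of "k + 2"] len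
      by (auto simp: R_def three_cycle_def edges_def)
  qed
  moreover have "set p \<subseteq> branch z w" using inB by (auto simp: p_def)
  ultimately show ?thesis using that by blast
qed

text \<open>By \<open>at_most_three\<close> the only edges at \<open>w\<close> are \<open>x\<close>,
  \<open>y\<close> and \<open>z\<close>, so a string from \<open>z\<close> avoiding the other two
  cannot leave the branch through \<open>w\<close>. Conversely \<open>x\<close> and \<open>y\<close>
  are not in the branch, whose edges are reached by strings inside it.\<close>

lemma rooted_subquiver_branch:
  assumes x: "x \<in> verts Q" and y: "y \<in> verts Q" and z: "z \<in> verts Q" and d: "distinct [x, y, z]"
    and w: "w \<in> E x" "w \<in> E y" "w \<in> E z"
  shows "rooted_subquiver Q z x y = full_subquiver Q (branch z w)"
proof -
  have "v \<in> branch z w" if p: "string_from_to Q p z v" "x \<notin> set p" "y \<notin> set p" for p v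
  proof -
    have "p ! k \<in> branch z w" if "k < length p" for k
      using that
    proof (induction k)
      case 0
      then show ?case using p(1) z by (simp add: string_from_to_def hd_conv_nth root_in_branch)
    next
      case (Suc k)
      let ?a = "p ! k" and ?b = "p ! Suc k"
      have a: "?a \<in> branch z w" "?a \<in> verts Q" using Suc branch_subset by auto
      have "?b \<in> set p" using Suc by simp
      then have b: "?b \<in> verts Q" "?b \<noteq> x" "?b \<noteq> y" using p by (auto simp: string_from_to_def)
      have "edges Q ?a ?b > 0" using p(1) Suc by (auto simp: string_from_to_def)
      then have "?a \<noteq> ?b" by (auto simp: edges_def)
      then have "E ?a \<inter> E ?b \<noteq> {}"
        using edges_eq[OF a(2) b(1)] \<open>edges Q ?a ?b > 0\<close> by auto
      then obtain c where c: "c \<in> E ?a" "c \<in> E ?b" by blast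
      show ?case
      proof (cases "c = w")
        case True
        then show ?thesis
          using at_most_three[of x y z ?b w] x y z w d b c root_in_branch[OF z] by auto
      next
        case False
        then show ?thesis using branchI[OF z b(1) c(2)] branchD[OF z w(3) a(1) c(1)] by simp
      qed
    qed
    from this[of "length p - 1"] show ?thesis
      using p(1) by (auto simp: string_from_to_def last_conv_nth)
  qed
  moreover have "\<exists>p. string_from_to Q p z v \<and> x \<notin> set p \<and> y \<notin> set p" if v: "v \<in> branch z w" for v
  proof -
    have "x \<notin> branch z w" "y \<notin> branch z w" using w d by (auto simp: branch_def subset_iff)
    moreover obtain p where "string_from_to Q p z v" "set p \<subseteq> branch z w"
      using branch_string[OF z w(3) v] .
    ultimately show ?thesis by blast
  qed
  ultimately have "{v \<in> verts Q. \<exists>p. string_from_to Q p z v \<and> x \<notin> set p \<and> y \<notin> set p} = branch z w"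
    using branch_subset by blast
  then show ?thesis by (simp add: rooted_subquiver_def)
qed

end


section \<open>Strings between end vertices\<close>

text \<open>The tree vertices are numbered so that the vertex of the quiver labelled \<open>L x\<close> becomes the
  tree edge joining \<open>L x\<close> and \<open>H x\<close>; its root is then \<open>\<alpha>\<^bsub>L x\<^esub> + \<dots> + \<alpha>\<^bsub>H x - 1\<^esub>\<close>.\<close>

definition numbering ::
  "'v quiver \<Rightarrow> ('v \<Rightarrow> nat set) \<Rightarrow> 'v \<Rightarrow> nat \<Rightarrow> ('v \<Rightarrow> nat) \<Rightarrow> (nat \<Rightarrow> nat) \<Rightarrow> ('v \<Rightarrow> nat) \<Rightarrow> bool" where
  "numbering Q E f c L \<nu> H \<longleftrightarrow>
     inj_on \<nu> (\<Union> (E ` verts Q)) \<and> inj_on L (verts Q) \<and>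
     (\<forall>x\<in>verts Q. \<nu> ` E x = {L x, H x} \<and> L x < H x \<and> 1 \<le> L x \<and> H x \<le> Suc (card (verts Q))) \<and>
     \<nu> c = Suc (card (verts Q)) \<and> L f = card (verts Q) \<and>
     (\<forall>x y z. three_cycle Q x y z \<and> L x < L y \<and> L y < L z \<longrightarrow> H x = Suc (L y)) \<and>
     (\<forall>x\<in>verts Q. \<not> (\<exists>y z. three_cycle Q x y z \<and> L x < L y \<and> L y < L z) \<longrightarrow> H x = Suc (L x))"

text \<open>A string between end vertices is a path \<open>w 0, \<dots>, w m\<close> in the tree joining two leaves.\<close>

locale tree_string = tree_quiver Q E C for Q :: "'v quiver" and E C +
  fixes p :: "'v list" and w :: "nat \<Rightarrow> nat" and m :: nat and e f
  assumes m: "m = length p" "2 \<le> m"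
    and p_verts: "k < m \<Longrightarrow> p ! k \<in> verts Q"
    and p_ends: "hd p = e" "last p = f"
    and E_p: "k < m \<Longrightarrow> E (p ! k) = {w k, w (Suc k)}"
    and inj_w: "inj_on w {..m}"
    and free_ends: "free_end Q E e (w 0)" "free_end Q E f (w m)"

context tree_quiver
begin

text \<open>Starting from the leaf \<open>a\<close>, each edge of \<open>p\<close> is traversed to
  its other end. Reducedness and the ban on two consecutive arrows of a 3-cycle make the next edge
  attach there; cuts show that no tree vertex recurs.\<close>

lemma string_tree_string:
  assumes p: "string_from_to Q p e f" and "e \<noteq> f" and e: "free_end Q E e a" and f: "free_end Q E f c"
  obtains w where "tree_string Q E C p w (length p) e f" "w (length p) = c"
proof -
  define m where "m = length p"
  have "p \<noteq> []" and hd: "hd p = e" and last: "last p = f" using p by (auto simp: string_from_to_def)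
  have m2: "2 \<le> m"
  proof (rule ccontr)
    assume "\<not> 2 \<le> m"
    moreover have "m > 0" using \<open>p \<noteq> []\<close> by (simp add: m_def)
    ultimately have "m = 1" by linarith
    then show False using hd last \<open>e \<noteq> f\<close> by (auto simp: m_def length_Suc_conv)
  qed
  have pV: "p ! k \<in> verts Q" if "k < m" for k
    using p that by (auto simp: string_from_to_def m_def)
  have p0: "p ! 0 = e" and pm: "p ! (m - 1) = f"
    using hd last \<open>p \<noteq> []\<close> by (auto simp: m_def hd_conv_nth last_conv_nth)
  have adj: "p ! k \<noteq> p ! Suc k \<and> E (p ! k) \<inter> E (p ! Suc k) \<noteq> {}" if k: "Suc k < m" for k
  proof -
    have pos: "edges Q (p ! k) (p ! Suc k) > 0" using p k by (auto simp: string_from_to_def m_def)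
    then have "p ! k \<noteq> p ! Suc k" by (auto simp: edges_def)
    then show ?thesis using edges_eq[of "p ! k" "p ! Suc k"] pV[of k] pV[of "Suc k"] k pos by auto
  qed
  have reduced: "p ! k \<noteq> p ! Suc (Suc k) \<and> \<not> three_cycle Q (p ! k) (p ! Suc k) (p ! Suc (Suc k))"
    if "Suc (Suc k) < m" for k
    using p that by (auto simp: string_from_to_def m_def)
  define w where "w = rec_nat a (\<lambda>k b. SOME d. d \<noteq> b \<and> E (p ! k) = {b, d})"
  have w0: "w 0 = a" by (simp add: w_def)
  have step: "w (Suc k) \<noteq> w k \<and> E (p ! k) = {w k, w (Suc k)}" if k: "k < m" "w k \<in> E (p ! k)" for k
  proof -
    have w': "w (Suc k) = (SOME d. d \<noteq> w k \<and> E (p ! k) = {w k, d})" by (simp only: w_def nat.rec)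
    obtain d where "d \<noteq> w k" "E (p ! k) = {w k, d}" using other_end[OF pV[OF k(1)] k(2)] .
    then have "\<exists>d. d \<noteq> w k \<and> E (p ! k) = {w k, d}" by blast
    then show ?thesis unfolding w' by (rule someI_ex)
  qed
  have wE: "w k \<in> E (p ! k)" if "k < m" for k
    using that
  proof (induction k rule: less_induct)
    case (less n)
    show ?case
    proof (cases n)
      case 0
      then show ?thesis using p0 w0 e by (simp add: free_end_def)
    next
      case n: (Suc k)
      then have lt: "k < m" "Suc k < m" using less.prems by auto
      have Ek: "E (p ! k) = {w k, w (Suc k)}" using step[of k] less.IH[of k] n lt by simp
      \<comment> \<open>Otherwise the next edge would attach at the near end of
        \<open>p ! k\<close>. That end is the leaf \<open>a\<close> if \<open>k = 0\<close>; if not,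
        the preceding edge also ends there, and three successive vertices of the string would form a
        3-cycle.\<close>
      have "w k \<notin> E (p ! Suc k)"
      proof
        assume wk: "w k \<in> E (p ! Suc k)"
        show False
        proof (cases k)
          case 0
          then show ?thesis using e wk w0 p0 pV[OF lt(2)] adj[OF lt(2)] by (auto simp: free_end_def)
        next
          case k: (Suc l)
          then have "w k \<in> E (p ! l)" using step[of l] less.IH[of l] n lt by simp
          moreover have "p ! l \<in> verts Q" "p ! k \<in> verts Q" "p ! Suc k \<in> verts Q"
            using pV lt k by auto
          moreover have "p ! l \<noteq> p ! k" "p ! k \<noteq> p ! Suc k" "p ! l \<noteq> p ! Suc k"
            using adj[of l] adj[of k] reduced[of l] lt k by auto
          moreover have "w k \<in> E (p ! k)" using Ek by simp
          ultimately have "three_cycle Q (p ! l) (p ! k) (p ! Suc k)"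
            using wk by (auto simp: three_cycle_iff)
          then show ?thesis using reduced[of l] lt k by simp
        qed
      qed
      then show ?thesis using adj[OF lt(2)] Ek n by auto
    qed
  qed
  have wne: "w (Suc k) \<noteq> w k" and Ep: "E (p ! k) = {w k, w (Suc k)}" if "k < m" for k
    using step[OF that wE[OF that]] by auto
  \<comment> \<open>The cut of \<open>p ! i\<close> is crossed on the step from \<open>w i\<close>
    and never again: a later step along the same edge would have to start at \<open>w i\<close> or
    \<open>w (Suc i)\<close>, which the induction hypothesis excludes.\<close>
  have sep: "(w j \<in> C (p ! i)) \<noteq> (w i \<in> C (p ! i))" if "i < j" "j \<le> m" for i j
    using that
  proof (induction j arbitrary: i)
    case (Suc j)
    have i: "i < m" and j: "j < m" using Suc by auto
    show ?case
    proof (cases "p ! i = p ! j")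
      case False
      have "w j \<in> C (p ! i) \<longleftrightarrow> w (Suc j) \<in> C (p ! i)"
        using cut_same[OF pV[OF i] pV[OF j] False] Ep[OF j] by auto
      moreover have "i < j" using False Suc.prems by (metis less_antisym)
      ultimately show ?thesis using Suc.IH[of i] j by simp
    next
      case True
      show ?thesis
      proof (cases "i = j")
        case True
        then show ?thesis using cut_diff[OF pV[OF i], of "w i" "w (Suc i)"] Ep[OF i] wne[OF i] by auto
      next
        case False
        then have ij: "i < j" using Suc.prems by simp
        then have "Suc i \<noteq> j" using adj[of i] True j by auto
        then have "Suc i < j" using ij by simp
        have "w j \<noteq> w i" using Suc.IH[OF ij] j by auto
        moreover have "w j \<noteq> w (Suc i)" using Suc.IH[OF \<open>Suc i < j\<close>] j by auto
        ultimately have False using Ep[OF i] Ep[OF j] True by (auto simp: doubleton_eq_iff)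
        then show ?thesis ..
      qed
    qed
  qed simp
  have inj: "inj_on w {..m}"
  proof (rule linorder_inj_onI)
    fix i j assume "i < j" "i \<in> {..m}" "j \<in> {..m}"
    then show "w i \<noteq> w j" using sep[of i j] by auto
  qed linarith
  have "w m = c"
  proof -
    obtain l where l: "m = Suc (Suc l)" using m2 by (metis Suc_le_D numeral_2_eq_2 Suc_le_mono)
    have "c \<in> {w (Suc l), w m}" using f Ep[of "Suc l"] pm l by (auto simp: free_end_def)
    moreover have "c \<noteq> w (Suc l)"
    proof
      assume "c = w (Suc l)"
      then have "p ! l = f" using f Ep[of l] pV[of l] l by (auto simp: free_end_def)
      then show False using adj[of l] pm l by auto
    qed
    ultimately show ?thesis by simp
  qed
  have "tree_string Q E C p w m e f"
  proof (rule tree_string.intro[OF tree_quiver_axioms], rule tree_string_axioms.intro)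
    show "E (p ! k) = {w k, w (Suc k)}" if "k < m" for k using Ep[OF that] .
    show "free_end Q E e (w 0)" "free_end Q E f (w m)" using e f w0 \<open>w m = c\<close> by simp_all
  qed (fact m_def m2 hd last inj pV)+
  then show ?thesis using that \<open>w m = c\<close> by (simp add: m_def)
qed

end

context tree_string
begin

lemma p_0: "p ! 0 = e" and p_last: "p ! (m - 1) = f"
proof -
  have "p \<noteq> []" using m by auto
  then show "p ! 0 = e" "p ! (m - 1) = f" using p_ends m(1) by (auto simp: hd_conv_nth last_conv_nth)
qed

lemma w_eq_iff: "i \<le> m \<Longrightarrow> j \<le> m \<Longrightarrow> w i = w j \<longleftrightarrow> i = j"
  using inj_w by (auto simp: inj_on_def)

lemma p_eq_iff:
  assumes "i < m" "j < m" shows "p ! i = p ! j \<longleftrightarrow> i = j"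
proof
  assume "p ! i = p ! j"
  then have "{w i, w (Suc i)} = {w j, w (Suc j)}" using E_p[of i] E_p[of j] assms by simp
  then show "i = j" using assms w_eq_iff by (auto simp: doubleton_eq_iff)
qed simp

text \<open>The complementary vertex \<open>z\<close> corresponding to the relative primary vertex \<open>p ! k\<close> is the third
  tree edge at \<open>w (Suc k)\<close>; \<open>hanging k\<close> is the vertex set of the subquiver
  rooted there, empty if there is no such \<open>z\<close>.\<close>

definition third :: "nat \<Rightarrow> 'v \<Rightarrow> bool" where
  "third k z \<longleftrightarrow> Suc k < m \<and> z \<in> verts Q \<and> w (Suc k) \<in> E z \<and> z \<noteq> p ! k \<and> z \<noteq> p ! Suc k"

definition hanging :: "nat \<Rightarrow> 'v set" where
  "hanging k = {v. \<exists>z. third k z \<and> v \<in> branch z (w (Suc k))}"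

lemma third_unique:
  assumes "third k z" "third k z'" shows "z' = z"
proof -
  have k: "Suc k < m" "k < m" and z: "z \<in> verts Q" "w (Suc k) \<in> E z"
      and z': "z' \<in> verts Q" "w (Suc k) \<in> E z'"
    using assms by (auto simp: third_def)
  have w: "w (Suc k) \<in> E (p ! k)" "w (Suc k) \<in> E (p ! Suc k)"
    unfolding E_p[OF k(1)] E_p[OF k(2)] by simp_all
  have "p ! k \<noteq> p ! Suc k" using p_eq_iff[OF k(2,1)] by simp
  then have "distinct [p ! k, p ! Suc k, z]" using assms(1) by (auto simp: third_def)
  then have "z' \<in> {p ! k, p ! Suc k, z}"
    by (rule at_most_three[OF p_verts[OF k(2)] p_verts[OF k(1)] z(1) z'(1) w z(2) z'(2)])
  then show ?thesis using assms by (auto simp: third_def)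
qed

lemma hanging_eq:
  assumes "third k z" shows "hanging k = branch z (w (Suc k))"
proof -
  have "third k z' \<longleftrightarrow> z' = z" for z' using third_unique[OF assms] assms by blast
  then show ?thesis by (simp add: hanging_def)
qed

lemma hanging_empty: "\<not> (\<exists>z. third k z) \<Longrightarrow> hanging k = {}"
  by (auto simp: hanging_def)

lemma three_cycle_third:
  "third k z \<Longrightarrow> three_cycle Q (p ! k) (p ! Suc k) z"
  using p_verts[of k] p_verts[of "Suc k"] E_p[of k] E_p[of "Suc k"] p_eq_iff[of k "Suc k"]
  by (auto simp: third_def three_cycle_iff)

text \<open>Two edges of the path share a tree vertex only if they are consecutive, because
  \<open>w\<close> is injective. So the 3-cycle sits at \<open>w (Suc k)\<close>, and its third edge
  is off the path.\<close>

lemma relative_types_iff: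
  assumes k: "Suc k < m"
  shows "relative_types Q p (p ! k) y z \<longleftrightarrow> y = p ! Suc k \<and> third k z"
proof
  assume r: "relative_types Q p (p ! k) y z"
  then obtain i j where t: "three_cycle Q (p ! k) y z" "z \<notin> set p" and ij: "i < j" "j < m" "p ! i = p ! k" "y = p ! j"
    using m by (auto simp: relative_types_def)
  then have "i = k" using p_eq_iff[of i k] k by auto
  obtain a where a: "a \<in> E (p ! k)" "a \<in> E y" "a \<in> E z" "z \<in> verts Q" "z \<noteq> p ! k" "z \<noteq> y"
    using t by (auto simp: three_cycle_iff)
  then have "a = w (Suc k) \<and> j = Suc k"
    using E_p[of k] E_p[of j] ij \<open>i = k\<close> k w_eq_iff[of k j] w_eq_iff[of k "Suc j"] w_eq_iff[of "Suc k" j]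
      w_eq_iff[of "Suc k" "Suc j"] by auto
  then show "y = p ! Suc k \<and> third k z" using ij a k by (auto simp: third_def)
next
  assume r: "y = p ! Suc k \<and> third k z"
  then have t: "three_cycle Q (p ! k) y z" using three_cycle_third by simp
  have "z \<notin> set p"
  proof
    assume "z \<in> set p"
    then obtain j where j: "j < m" "z = p ! j" using m by (auto simp: in_set_conv_nth)
    then have "j = k \<or> j = Suc k"
      using r E_p[of j] w_eq_iff[of "Suc k" j] w_eq_iff[of "Suc k" "Suc j"] k by (auto simp: third_def)
    then show False using r j by (auto simp: third_def)
  qed
  then show "relative_types Q p (p ! k) y z"
    unfolding relative_types_def using t r k m(1) by blast
qed

lemma rooted_subquiver_third:
  assumes "third k z"
  shows "rooted_subquiver Q z (p ! k) (p ! Suc k) = full_subquiver Q (hanging k)"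
  unfolding hanging_eq[OF assms]
  using rooted_subquiver_branch[of "p ! k" "p ! Suc k" z "w (Suc k)"] three_cycle_third[OF assms] assms
    E_p[of k] E_p[of "Suc k"] by (auto simp: third_def three_cycle_iff)

lemma hanging_subset: "hanging k \<subseteq> verts Q"
  using branch_subset by (auto simp: hanging_def)

lemma third_in_hanging: "third k z \<Longrightarrow> z \<in> hanging k"
  by (auto simp: hanging_def third_def intro: root_in_branch)

lemma hanging_closed:
  assumes "x \<in> hanging k" "a \<in> E x" "a \<noteq> w (Suc k)" "y \<in> verts Q" "a \<in> E y"
  shows "y \<in> hanging k"
proof -
  obtain z where z: "third k z" using assms(1) by (auto simp: hanging_def)
  then have zV: "z \<in> verts Q" "w (Suc k) \<in> E z" by (auto simp: third_def)
  show ?thesis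
    using assms branchD[OF zV, of x a] branchI[OF zV(1) assms(4,5)] unfolding hanging_eq[OF z] by blast
qed

lemma vertex_at_w:
  assumes "v \<in> verts Q" "w j \<in> E v" "j \<le> m"
  shows "(j = 0 \<and> v = e) \<or> (j = m \<and> v = f) \<or>
    (\<exists>k. j = Suc k \<and> Suc k < m \<and> (v = p ! k \<or> v = p ! Suc k \<or> third k v))"
proof (cases "j = 0 \<or> j = m")
  case True
  then show ?thesis using assms free_ends by (auto simp: free_end_def)
next
  case False
  then obtain k where "j = Suc k" "Suc k < m" using assms(3) by (cases j) simp_all
  then show ?thesis using assms unfolding third_def by blast
qed

text \<open>Connectedness: the path with everything hanging off it has no further edges at its tree
  vertices, since the ends of the path are leaves and each inner path vertex has at most one third
  edge.\<close>

lemma vertex_cases: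
  assumes "v \<in> verts Q"
  obtains k where "k < m" "v \<in> insert (p ! k) (hanging k)"
proof -
  define U where "U = (\<Union>k<m. insert (p ! k) (hanging k))"
  define A where "A = w ` {..m} \<union> (\<Union>k<m. \<Union> (E ` hanging k))"
  have UA: "E y \<subseteq> A" if y: "y \<in> U" for y
  proof -
    obtain k where k: "k < m" "y = p ! k \<or> y \<in> hanging k" using y by (auto simp: U_def)
    then show ?thesis using E_p[of k] by (auto simp: A_def)
  qed
  have at_w: "y \<in> U" if y: "y \<in> verts Q" "w j \<in> E y" "j \<le> m" for y j
    using vertex_at_w[OF y]
  proof (elim disjE conjE exE)
    assume "y = e"
    then show ?thesis using p_0 m by (auto simp: U_def)
  next
    assume "y = f"
    then show ?thesis using p_last m by (auto simp: U_def)
  next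
    fix k assume "Suc k < m" "y = p ! k"
    then show ?thesis by (auto simp: U_def)
  next
    fix k assume "Suc k < m" "y = p ! Suc k"
    then show ?thesis by (auto simp: U_def)
  next
    fix k assume "Suc k < m" "third k y"
    then show ?thesis using third_in_hanging[of k y] by (auto simp: U_def intro!: bexI[of _ k])
  qed
  have AU: "y \<in> U" if y: "y \<in> verts Q" "a \<in> E y" "a \<in> A" for y a
  proof (cases "a \<in> w ` {..m}")
    case True
    then show ?thesis using at_w y by auto
  next
    case False
    then obtain k x where "k < m" "x \<in> hanging k" "a \<in> E x" using y by (auto simp: A_def)
    moreover then have "a \<noteq> w (Suc k)" using False by auto
    ultimately show ?thesis using hanging_closed[of x k a y] y by (auto simp: U_def)
  qed
  have "E v \<subseteq> A"
  proof (rule conn[of A "p ! 0" v])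
    show "E y \<subseteq> A \<or> E y \<inter> A = {}" if "y \<in> verts Q" for y
      using AU[OF that] UA by blast
    show "p ! 0 \<in> verts Q" using p_verts[of 0] m(2) by simp
    show "E (p ! 0) \<subseteq> A" using m(2) by (intro UA) (auto simp: U_def)
  qed (rule assms)
  moreover have "E v \<noteq> {}" using card_E[OF assms] by auto
  ultimately have "v \<in> U" using AU[OF assms] by blast
  then show ?thesis using that by (auto simp: U_def)
qed

end


section \<open>Numbering the tree along the labelling procedure\<close>

context tree_string
begin

text \<open>The output of a recursive call, already shifted by \<open>L (p ! k)\<close> and
  expressed through the labels of the whole quiver. All conditions are vacuous if nothing hangs at
  \<open>k\<close>, so gluing needs no case distinction.\<close>

definition block_numbering :: "('v \<Rightarrow> nat) \<Rightarrow> nat \<Rightarrow> (nat \<Rightarrow> nat) \<Rightarrow> ('v \<Rightarrow> nat) \<Rightarrow> bool" where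
  "block_numbering L k \<mu> \<eta> \<longleftrightarrow>
     inj_on \<mu> (\<Union> (E ` hanging k)) \<and> inj_on L (hanging k) \<and>
     (\<forall>x\<in>hanging k. \<mu> ` E x = {L x, \<eta> x} \<and> L x < \<eta> x \<and> L (p ! k) < L x \<and>
        \<eta> x \<le> Suc (L (p ! k) + card (hanging k))) \<and>
     (\<forall>z. third k z \<longrightarrow> \<mu> (w (Suc k)) = Suc (L (p ! k) + card (hanging k)) \<and>
        L z = L (p ! k) + card (hanging k)) \<and>
     (\<forall>x\<in>hanging k. \<forall>y\<in>hanging k. \<forall>z\<in>hanging k.
        three_cycle Q x y z \<and> L x < L y \<and> L y < L z \<longrightarrow> \<eta> x = Suc (L y)) \<and>
     (\<forall>x\<in>hanging k. \<not> (\<exists>y\<in>hanging k. \<exists>z\<in>hanging k. three_cycle Q x y z \<and> L x < L y \<and> L y < L z) \<longrightarrow>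
        \<eta> x = Suc (L x))"

lemma block_numbering_shift:
  assumes z: "third k z"
    and num: "numbering (full_subquiver Q (hanging k)) E z (w (Suc k)) L' \<nu> H"
    and L: "\<forall>v\<in>hanging k. L v = L (p ! k) + L' v"
  shows "block_numbering L k (\<lambda>a. L (p ! k) + \<nu> a) (\<lambda>x. L (p ! k) + H x)"
proof -
  let ?l = "L (p ! k)"
  have n: "inj_on \<nu> (\<Union> (E ` hanging k))" "inj_on L' (hanging k)"
      "\<And>x. x \<in> hanging k \<Longrightarrow> \<nu> ` E x = {L' x, H x} \<and> L' x < H x \<and> 1 \<le> L' x \<and> H x \<le> Suc (card (hanging k))"
      "\<nu> (w (Suc k)) = Suc (card (hanging k))" "L' z = card (hanging k)"
      "\<And>x y z. x \<in> hanging k \<Longrightarrow> y \<in> hanging k \<Longrightarrow> z \<in> hanging k \<Longrightarrow> three_cycle Q x y z \<Longrightarrow>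
         L' x < L' y \<Longrightarrow> L' y < L' z \<Longrightarrow> H x = Suc (L' y)"
      "\<And>x. x \<in> hanging k \<Longrightarrow>
         \<not> (\<exists>y\<in>hanging k. \<exists>z\<in>hanging k. three_cycle Q x y z \<and> L' x < L' y \<and> L' y < L' z) \<Longrightarrow> H x = Suc (L' x)"
    using num unfolding numbering_def three_cycle_full_subquiver
    by simp_all metis+
  have Lx: "L v = ?l + L' v" if "v \<in> hanging k" for v using L that by blast
  show ?thesis
    unfolding block_numbering_def
  proof (intro conjI ballI allI impI)
    show "inj_on (\<lambda>a. ?l + \<nu> a) (\<Union> (E ` hanging k))" using n(1) by (simp add: inj_on_def)
    show "inj_on L (hanging k)" using n(2) Lx by (simp add: inj_on_def)
  next
    fix x assume x: "x \<in> hanging k"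
    have "(\<lambda>a. ?l + \<nu> a) ` E x = (\<lambda>i. ?l + i) ` (\<nu> ` E x)" by (simp add: image_image)
    then show "(\<lambda>a. ?l + \<nu> a) ` E x = {L x, ?l + H x}" using n(3)[OF x] Lx[OF x] by simp
    show "L x < ?l + H x" "?l < L x" "?l + H x \<le> Suc (?l + card (hanging k))"
      using n(3)[OF x] Lx[OF x] by auto
  next
    fix z' assume "third k z'"
    then have "z' = z" using third_unique[OF z] by blast
    then show "?l + \<nu> (w (Suc k)) = Suc (?l + card (hanging k))" "L z' = ?l + card (hanging k)"
      using n(4,5) Lx[OF third_in_hanging[OF z]] by simp_all
  next
    fix x y z assume "x \<in> hanging k" "y \<in> hanging k" "z \<in> hanging k"
      and "three_cycle Q x y z \<and> L x < L y \<and> L y < L z"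
    then show "?l + H x = Suc (L y)" using n(6)[of x y z] Lx by simp
  next
    fix x assume "x \<in> hanging k"
      and "\<not> (\<exists>y\<in>hanging k. \<exists>z\<in>hanging k. three_cycle Q x y z \<and> L x < L y \<and> L y < L z)"
    then show "?l + H x = Suc (L x)" using n(7)[of x] Lx by simp
  qed
qed

lemma block_numbering_empty: "\<not> (\<exists>z. third k z) \<Longrightarrow> block_numbering L k \<mu> \<eta>"
  by (simp add: block_numbering_def hanging_empty)

text \<open>The labels of \<open>p ! k\<close> and of \<open>hanging k\<close> lie in the half-open
  interval from \<open>l k\<close> to \<open>l (Suc k)\<close>. Disjointness of these intervals
  gives injectivity across blocks, and the block numberings agree with the path at the attaching
  vertices.\<close>

lemma numbering_from_blocks:
  assumes L_e: "L e = 1"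
    and L_step: "\<And>k. Suc k < m \<Longrightarrow> L (p ! Suc k) = Suc (L (p ! k) + card (hanging k))"
    and blocks: "\<And>k. k < m \<Longrightarrow> \<exists>\<mu> \<eta>. block_numbering L k \<mu> \<eta>"
  shows "\<exists>\<nu> H. numbering Q E f (w m) L \<nu> H"
proof -
  have "\<forall>k. \<exists>\<mu> \<eta>. k < m \<longrightarrow> block_numbering L k \<mu> \<eta>" using blocks by blast
  then obtain \<mu> \<eta> where "\<And>k. k < m \<Longrightarrow> block_numbering L k (\<mu> k) (\<eta> k)" by metis
  then have inj_\<mu>: "inj_on (\<mu> k) (\<Union> (E ` hanging k))" and inj_L: "inj_on L (hanging k)"
    and \<mu>E: "x \<in> hanging k \<Longrightarrow> \<mu> k ` E x = {L x, \<eta> k x}"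
    and L\<eta>: "x \<in> hanging k \<Longrightarrow> L x < \<eta> k x"
    and L_lower: "x \<in> hanging k \<Longrightarrow> L (p ! k) < L x"
    and \<eta>_upper: "x \<in> hanging k \<Longrightarrow> \<eta> k x \<le> Suc (L (p ! k) + card (hanging k))"
    and \<mu>_third: "third k z \<Longrightarrow> \<mu> k (w (Suc k)) = Suc (L (p ! k) + card (hanging k))"
    and L_third: "third k z \<Longrightarrow> L z = L (p ! k) + card (hanging k)"
    and \<eta>_primary: "x \<in> hanging k \<Longrightarrow> y \<in> hanging k \<Longrightarrow> z \<in> hanging k \<Longrightarrow> three_cycle Q x y z \<Longrightarrow>
        L x < L y \<Longrightarrow> L y < L z \<Longrightarrow> \<eta> k x = Suc (L y)"
    and \<eta>_nonprimary: "x \<in> hanging k \<Longrightarrow>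
        \<not> (\<exists>y z. three_cycle Q x y z \<and> L x < L y \<and> L y < L z) \<Longrightarrow> \<eta> k x = Suc (L x)"
    if "k < m" for k x y z
    using that unfolding block_numbering_def by blast+
  \<comment> \<open>\<open>l k\<close> will be the number of \<open>w k\<close>. No path edge starts
    at the last vertex \<open>w m\<close>, which receives one more than the last label.\<close>
  define l where "l k = (if k < m then L (p ! k) else Suc (L f))" for k
  have l_p: "L (p ! k) = l k" if "k < m" for k using that by (simp add: l_def)
  have l0: "l 0 = 1" using L_e p_0 m(2) by (simp add: l_def)
  have no_last: "hanging k = {}" if "\<not> Suc k < m" for k using that by (auto simp: hanging_def third_def)
  have l_Suc: "l (Suc k) = Suc (l k + card (hanging k))" if "k < m" for k
  proof (cases "Suc k < m")
    case True
    then show ?thesis using L_step[OF True] by (simp add: l_def)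
  next
    case False
    then have "k = m - 1" using that by simp
    then show ?thesis using that p_last no_last[OF False] by (simp add: l_def)
  qed
  have l_less: "l i < l j" if "i < j" "j \<le> m" for i j
    using that
  proof (induction j)
    case (Suc j)
    have "l j < l (Suc j)" using l_Suc[of j] Suc.prems by simp
    then show ?case using Suc by (cases "i = j") auto
  qed simp
  have l_le: "l i \<le> l j" if "i \<le> j" "j \<le> m" for i j
    using l_less[of i j] that by (cases "i = j") auto
  have idx: "i = j" if "i < m" "j < m" "l i \<le> a" "a < l (Suc i)" "l j \<le> a" "a < l (Suc j)" for i j a
  proof (rule ccontr)
    assume "i \<noteq> j"
    then consider "Suc i \<le> j" | "Suc j \<le> i" by linarith
    then show False using l_le[of "Suc i" j] l_le[of "Suc j" i] that by cases auto
  qed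
  have L_upper: "L x < l (Suc k)" if "k < m" "x \<in> hanging k" for k x
    using L\<eta>[OF that] \<eta>_upper[OF that] l_Suc[OF that(1)] l_p[OF that(1)] by simp
  have L_block: "l k \<le> L x \<and> L x < l (Suc k)" if "k < m" "x \<in> insert (p ! k) (hanging k)" for k x
    using that L_lower[of k x] L_upper[of k x] l_p[of k] l_Suc[of k] by auto
  have same_block: "i = j" if "i < m" "x \<in> insert (p ! i) (hanging i)" "j < m" "y \<in> insert (p ! j) (hanging j)" "L x = L y"
    for i j x y
    using idx[of i j "L x"] L_block[of i x] L_block[of j y] that by simp
  have p_not_hanging: "p ! j \<notin> hanging k" if "j < m" "k < m" for j k
  proof
    assume *: "p ! j \<in> hanging k"
    then have "j = k" using same_block[of j "p ! j" k "p ! j"] that by simp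
    then show False using L_lower[OF that(2) *] by simp
  qed
  \<comment> \<open>Every \<open>w j\<close> is an end of some path edge, and that edge would have
    to hang at \<open>k\<close> as well.\<close>
  have w_not_hanging: "a \<noteq> w j" if prems: "k < m" "x \<in> hanging k" "a \<in> E x" "a \<noteq> w (Suc k)" "j \<le> m" for k x a j
  proof
    assume "a = w j"
    obtain i where i: "i < m" "w j \<in> E (p ! i)"
    proof (cases "j < m")
      case True
      then show ?thesis using that E_p[of j] by blast
    next
      case False
      then have "j = Suc (m - 1)" "m - 1 < m" using prems(5) m(2) by auto
      then show ?thesis using that E_p[of "m - 1"] by blast
    qed
    then have "p ! i \<in> hanging k"
      using hanging_closed[of x k a "p ! i"] prems p_verts \<open>a = w j\<close> by blast
    then show False using p_not_hanging i(1) prems(1) by blast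
  qed
  have hanging_third: "\<exists>z. third k z" if "x \<in> hanging k" for k x using that by (auto simp: hanging_def)
  have \<mu>_w: "\<mu> k (w (Suc k)) = l (Suc k)" if "k < m" "x \<in> hanging k" for k x
    using hanging_third[OF that(2)] \<mu>_third[OF that(1)] l_Suc[OF that(1)] l_p[OF that(1)] by auto
  have \<mu>_range: "l k < \<mu> k a \<and> \<mu> k a < l (Suc k)" if prems: "k < m" "x \<in> hanging k" "a \<in> E x" "a \<noteq> w (Suc k)" for k x a
  proof -
    obtain z where z: "third k z" using hanging_third[OF prems(2)] by blast
    have "\<mu> k a \<in> {L x, \<eta> k x}" using \<mu>E[OF prems(1,2)] prems(3) by blast
    then have "l k < \<mu> k a \<and> \<mu> k a \<le> l (Suc k)"
      using L\<eta>[OF prems(1,2)] L_lower[OF prems(1,2)] \<eta>_upper[OF prems(1,2)] l_Suc[OF prems(1)] l_p[OF prems(1)] by auto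
    moreover have "\<mu> k a \<noteq> \<mu> k (w (Suc k))"
      using inj_\<mu>[OF prems(1)] prems third_in_hanging[OF z] z by (auto simp: inj_on_def third_def)
    ultimately show ?thesis using \<mu>_w[OF prems(1,2)] by simp
  qed
  \<comment> \<open>Well-definedness of the glued numbering: a path vertex lies in the block
    \<open>k\<close> only as \<open>w (Suc k)\<close>, where both rules give
    \<open>l (Suc k)\<close>, and different blocks share no tree vertex off the path.\<close>
  have "\<exists>i. (\<forall>k\<le>m. a = w k \<longrightarrow> i = l k) \<and> (\<forall>k<m. \<forall>x\<in>hanging k. a \<in> E x \<longrightarrow> i = \<mu> k a)" for a
  proof (cases "\<exists>k\<le>m. a = w k")
    case True
    then obtain k where k: "k \<le> m" "a = w k" by blast
    have "l k = \<mu> j a" if "j < m" "x \<in> hanging j" "a \<in> E x" for j x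
    proof -
      have "a = w (Suc j)" using w_not_hanging[OF that(1,2,3) _ k(1)] k(2) by blast
      then have "k = Suc j" using k w_eq_iff[of k "Suc j"] that(1) by simp
      then show ?thesis using \<mu>_w[OF that(1,2)] k by simp
    qed
    then show ?thesis using k w_eq_iff by (intro exI[of _ "l k"]) auto
  next
    case False
    have "\<mu> j a = \<mu> k a" if "j < m" "x \<in> hanging j" "a \<in> E x" "k < m" "y \<in> hanging k" "a \<in> E y" for j x k y
    proof -
      have "a \<noteq> w (Suc j)" using False that(1) by auto
      then have "y \<in> hanging j" using hanging_closed[OF that(2,3) _ _ that(6)] that(5) hanging_subset by blast
      then have "j = k" using same_block[of j y k y] that by blast
      then show ?thesis by simp
    qed
    then show ?thesis using False by metis
  qed
  then obtain \<nu> where \<nu>: "\<And>a. (\<forall>k\<le>m. a = w k \<longrightarrow> \<nu> a = l k) \<and> (\<forall>k<m. \<forall>x\<in>hanging k. a \<in> E x \<longrightarrow> \<nu> a = \<mu> k a)"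
    by metis
  have \<nu>_w: "\<nu> (w k) = l k" if "k \<le> m" for k using \<nu>[of "w k"] that by blast
  have \<nu>_hanging: "\<nu> a = \<mu> k a" if "k < m" "x \<in> hanging k" "a \<in> E x" for k x a using \<nu>[of a] that by blast
  have tree_vertex: "(\<exists>k\<le>m. a = w k) \<or> (\<exists>k<m. \<exists>x\<in>hanging k. a \<in> E x \<and> a \<noteq> w (Suc k))"
    if v: "v \<in> verts Q" "a \<in> E v" for a v
  proof -
    obtain k where k: "k < m" "v \<in> insert (p ! k) (hanging k)" using vertex_cases[OF v(1)] .
    then consider "a \<in> {w k, w (Suc k)}" | "v \<in> hanging k" "a \<noteq> w (Suc k)" using v E_p[of k] by blast
    then show ?thesis
    proof cases
      case 1
      then show ?thesis using k(1) by (metis Suc_leI insertE less_imp_le_nat singletonD)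
    qed (use k that in blast)
  qed
  have inj_\<nu>: "inj_on \<nu> (\<Union> (E ` verts Q))"
  proof (rule inj_onI)
    fix a b assume "a \<in> \<Union> (E ` verts Q)" "b \<in> \<Union> (E ` verts Q)" and eq: "\<nu> a = \<nu> b"
    then have ab: "(\<exists>k\<le>m. a = w k) \<or> (\<exists>k<m. \<exists>x\<in>hanging k. a \<in> E x \<and> a \<noteq> w (Suc k))"
        "(\<exists>k\<le>m. b = w k) \<or> (\<exists>k<m. \<exists>x\<in>hanging k. b \<in> E x \<and> b \<noteq> w (Suc k))"
      using tree_vertex by blast+
    \<comment> \<open>Numbers off the path lie strictly between consecutive values of
      \<open>l\<close>, hence differ from all of them.\<close>
    have mixed: False if "k \<le> m" "\<nu> a' = l k" "j < m" "x \<in> hanging j" "a' \<in> E x" "a' \<noteq> w (Suc j)" for k j x a'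
    proof -
      have *: "l j < l k \<and> l k < l (Suc j)" using \<mu>_range[OF that(3-6)] \<nu>_hanging[OF that(3-5)] that(2) by simp
      then have "j < k" using l_le[of k j] that by (metis leD leI less_imp_le_nat)
      then show False using * l_le[of "Suc j" k] that by simp
    qed
    from ab show "a = b"
    proof (elim disjE exE conjE bexE)
      fix i j assume "i \<le> m" "a = w i" "j \<le> m" "b = w j"
      then show ?thesis using eq \<nu>_w l_less[of i j] l_less[of j i] by (cases i j rule: linorder_cases) auto
    next
      fix i j x assume "i \<le> m" "a = w i" "j < m" "x \<in> hanging j" "b \<in> E x" "b \<noteq> w (Suc j)"
      then show ?thesis using mixed[of i b j x] eq \<nu>_w by simp
    next
      fix i j x assume "i \<le> m" "b = w i" "j < m" "x \<in> hanging j" "a \<in> E x" "a \<noteq> w (Suc j)"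
      then show ?thesis using mixed[of i a j x] eq \<nu>_w by simp
    next
      fix i x j y
      assume i: "i < m" "x \<in> hanging i" "a \<in> E x" "a \<noteq> w (Suc i)"
        and j: "j < m" "y \<in> hanging j" "b \<in> E y" "b \<noteq> w (Suc j)"
      have "i = j"
        using idx[of i j "\<nu> a"] \<mu>_range[OF i] \<mu>_range[OF j] \<nu>_hanging[OF i(1-3)] \<nu>_hanging[OF j(1-3)] eq i j by simp
      then show ?thesis
        using inj_\<mu>[OF i(1)] i j eq \<nu>_hanging[OF i(1-3)] \<nu>_hanging[OF j(1-3)] by (auto simp: inj_on_def)
    qed
  qed
  have inj_L': "inj_on L (verts Q)"
  proof (rule inj_onI)
    fix x y assume xy: "x \<in> verts Q" "y \<in> verts Q" "L x = L y"
    obtain i where i: "i < m" "x \<in> insert (p ! i) (hanging i)" using vertex_cases[OF xy(1)] .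
    obtain j where j: "j < m" "y \<in> insert (p ! j) (hanging j)" using vertex_cases[OF xy(2)] .
    have "i = j" using same_block[OF i j xy(3)] .
    then have "x = p ! i \<or> x \<in> hanging i" "y = p ! i \<or> y \<in> hanging i" using i j by auto
    then show "x = y"
      using inj_onD[OF inj_L[OF i(1)] xy(3)] L_lower[OF i(1)] xy(3) by (metis less_irrefl)
  qed
  have card_V: "Suc (card (verts Q)) = l m"
  proof -
    have "Suc (card (\<Union>k<i. insert (p ! k) (hanging k))) = l i" if "i \<le> m" for i
      using that
    proof (induction i)
      case 0
      then show ?case using l0 by simp
    next
      case (Suc i)
      let ?U = "\<Union>k<i. insert (p ! k) (hanging k)"
      have fin': "finite (hanging k)" for k using hanging_subset fin by (rule finite_subset)
      have "?U \<inter> insert (p ! i) (hanging i) = {}"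
      proof (rule ccontr)
        assume "?U \<inter> insert (p ! i) (hanging i) \<noteq> {}"
        then obtain x k where x: "k < i" "x \<in> insert (p ! k) (hanging k)" "x \<in> insert (p ! i) (hanging i)" by blast
        then have "k = i" using same_block[of k x i x] Suc.prems by simp
        then show False using x(1) by simp
      qed
      then have "card (insert (p ! i) (hanging i) \<union> ?U) = Suc (card (hanging i)) + card ?U"
        using card_Un_disjoint[of "insert (p ! i) (hanging i)" ?U] fin' p_not_hanging[of i i] Suc.prems
        by (simp add: Int_commute)
      then show ?case using Suc l_Suc[of i] by (simp add: lessThan_Suc)
    qed
    moreover have "(\<Union>k<m. insert (p ! k) (hanging k)) = verts Q"
    proof
      show "verts Q \<subseteq> (\<Union>k<m. insert (p ! k) (hanging k))" using vertex_cases by blast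
      show "(\<Union>k<m. insert (p ! k) (hanging k)) \<subseteq> verts Q" using p_verts hanging_subset by blast
    qed
    ultimately show ?thesis by (metis order_refl)
  qed
  have L_f: "L f = card (verts Q)" using card_V by (simp add: l_def)
  define H where "H x = Max (\<nu> ` E x)" for x
  have H_p: "\<nu> ` E (p ! k) = {l k, l (Suc k)} \<and> H (p ! k) = l (Suc k)" if "k < m" for k
  proof -
    have "\<nu> ` E (p ! k) = {l k, l (Suc k)}" using E_p[OF that] \<nu>_w[of k] \<nu>_w[of "Suc k"] that by simp
    then show ?thesis using l_less[of k "Suc k"] that by (simp add: H_def max_def)
  qed
  have H_hanging: "\<nu> ` E x = {L x, \<eta> k x} \<and> H x = \<eta> k x" if "k < m" "x \<in> hanging k" for k x
  proof -
    have "\<nu> ` E x = \<mu> k ` E x" using \<nu>_hanging[OF that] by (intro image_cong) auto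
    then have "\<nu> ` E x = {L x, \<eta> k x}" using \<mu>E[OF that] by simp
    then show ?thesis using L\<eta>[OF that] by (simp add: H_def max_def)
  qed
  have "numbering Q E f (w m) L \<nu> H"
    unfolding numbering_def
  proof (intro conjI ballI allI impI)
    show "\<nu> (w m) = Suc (card (verts Q))" using \<nu>_w[of m] card_V by simp
  next
    fix x assume x: "x \<in> verts Q"
    obtain k where k: "k < m" "x \<in> insert (p ! k) (hanging k)" using vertex_cases[OF x] .
    have "\<nu> ` E x = {L x, H x} \<and> L x < H x \<and> H x \<le> l (Suc k)"
    proof (cases "x = p ! k")
      case True
      then show ?thesis using H_p[OF k(1)] l_p[OF k(1)] l_less[of k "Suc k"] k(1) by simp
    next
      case False
      then have "x \<in> hanging k" using k by blast
      then show ?thesis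
        using H_hanging[OF k(1)] L\<eta>[OF k(1)] \<eta>_upper[OF k(1)] l_p[OF k(1)] l_Suc[OF k(1)] by auto
    qed
    moreover have "l (Suc k) \<le> l m" using l_le[of "Suc k" m] k(1) by simp
    moreover have "1 \<le> L x" using L_block[OF k] l_le[of 0 k] l0 k(1) by simp
    ultimately show "\<nu> ` E x = {L x, H x}" "L x < H x" "1 \<le> L x" "H x \<le> Suc (card (verts Q))"
      unfolding card_V by auto
  next
    fix x y z assume t: "three_cycle Q x y z \<and> L x < L y \<and> L y < L z"
    then obtain a where V: "x \<in> verts Q" "y \<in> verts Q" "z \<in> verts Q" and d: "distinct [x, y, z]"
      and a: "a \<in> E x" "a \<in> E y" "a \<in> E z" by (auto simp: three_cycle_iff)
    from tree_vertex[OF V(1) a(1)] show "H x = Suc (L y)"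
    proof (elim disjE exE conjE bexE)
      fix j assume j: "j \<le> m" "a = w j"
      have "x \<noteq> y" using d by simp
      moreover have "x = y" if "free_end Q E g (w j)" for g
        using that V(1,2) a(1,2) j(2) unfolding free_end_def by metis
      ultimately have "j \<noteq> 0" "j \<noteq> m" using free_ends by metis+
      then obtain k where k: "j = Suc k" "Suc k < m" using j(1) by (cases j) auto
      have c: "v = p ! k \<and> L v = l k \<or> v = p ! Suc k \<and> L v = l (Suc k) \<or> L v = l k + card (hanging k)"
        if "v \<in> verts Q" "a \<in> E v" for v
        using that j k l_p[of k] l_p[of "Suc k"] L_third[of k v] by (auto simp: third_def)
      \<comment> \<open>The labels at \<open>w (Suc k)\<close> are \<open>l k\<close> for the
        primary edge, \<open>l k + card (hanging k)\<close> for the third edge and one more for the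
        secondary edge, so their order identifies the roles.\<close>
      have "x = p ! k \<and> L y = l k + card (hanging k)"
        using c[OF V(1) a(1)] c[OF V(2) a(2)] c[OF V(3) a(3)] t l_Suc[of k] k by auto
      then show ?thesis using H_p[of k] l_Suc[of k] k by simp
    next
      fix k v assume "k < m" "v \<in> hanging k" "a \<in> E v" "a \<noteq> w (Suc k)"
      then show ?thesis
        using \<eta>_primary[of k x y z] hanging_closed[of v k a] V a t H_hanging[of k x] by simp
    qed
  next
    fix x assume x: "x \<in> verts Q" and np: "\<not> (\<exists>y z. three_cycle Q x y z \<and> L x < L y \<and> L y < L z)"
    obtain k where k: "k < m" "x \<in> insert (p ! k) (hanging k)" using vertex_cases[OF x] .
    show "H x = Suc (L x)"
    proof (cases "x = p ! k")
      case True
      \<comment> \<open>A third edge would have a label between those of \<open>p ! k\<close> and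
        \<open>p ! Suc k\<close>, making \<open>p ! k\<close> primary. So nothing hangs here and
        \<open>l\<close> increases by exactly 1.\<close>
      have "\<not> third k z" for z
      proof
        assume z: "third k z"
        then have "Suc k < m" by (simp add: third_def)
        moreover have "three_cycle Q (p ! k) z (p ! Suc k)"
          using three_cycle_third[OF z] by (auto simp: three_cycle_iff)
        moreover have "L (p ! k) < L z" "L z < l (Suc k)"
          using L_lower[OF k(1) third_in_hanging[OF z]] L_upper[OF k(1) third_in_hanging[OF z]] .
        ultimately show False using np True l_p by metis
      qed
      then have "hanging k = {}" using hanging_empty by blast
      then show ?thesis using H_p[OF k(1)] l_Suc[OF k(1)] l_p[OF k(1)] True by simp
    next
      case False
      then have "x \<in> hanging k" using k by blast
      then show ?thesis using \<eta>_nonprimary[OF k(1) _ np] H_hanging[OF k(1)] by simp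
    qed
  qed (fact inj_\<nu> inj_L' L_f)+
  then show ?thesis by blast
qed

end

text \<open>\<open>E\<close> and \<open>C\<close> stay fixed through the recursion. The leaf
  \<open>c\<close> is generalised because the call for the complementary vertex must be numbered
  with \<open>w (Suc k)\<close> last, even if that subquiver is a single vertex with two
  leaves.\<close>

lemma labelling_numbering:
  assumes "labelling Q e f L" "tree_quiver Q E C" "free_end Q E f c"
  shows "\<exists>\<nu> H. numbering Q E f c L \<nu> H"
  using assms
proof (induction arbitrary: c rule: labelling.induct)
  case (single Q v L)
  then interpret tree_quiver Q E C by simp
  have v: "v \<in> verts Q" "c \<in> E v" using single.prems by (auto simp: free_end_def)
  obtain b where b: "b \<noteq> c" "E v = {c, b}" using other_end[OF v] .
  have no: "\<not> three_cycle Q x y z" for x y z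
    using single.hyps(1) by (auto simp: three_cycle_iff)
  have "numbering Q E v c L (\<lambda>a. if a = c then 2 else 1) (\<lambda>_. 2)"
    unfolding numbering_def using single.hyps b no by (auto simp: inj_on_def)
  then show ?case by blast
next
  case (string Q e f p L)
  then interpret tree_quiver Q E C by simp
  obtain a where a: "free_end Q E e a" using end_vertex_free_end[OF string.hyps(2)] .
  obtain w where ts: "tree_string Q E C p w (length p) e f" and wc: "w (length p) = c"
    using string_tree_string[OF string.hyps(5,4) a string.prems(2)] .
  interpret tree_string Q E C p w "length p" e f by (rule ts)
  have rooted: "\<exists>L'. (\<forall>c. tree_quiver (full_subquiver Q (hanging k)) E C \<longrightarrow>
        free_end (full_subquiver Q (hanging k)) E z c \<longrightarrow>
        (\<exists>\<nu> H. numbering (full_subquiver Q (hanging k)) E z c L' \<nu> H)) \<and>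
      (\<forall>v\<in>hanging k. L v = L (p ! k) + L' v) \<and> L (p ! Suc k) = Suc (L (p ! k) + card (hanging k))"
    if z: "third k z" for k z
  proof -
    have k: "Suc k < length p" using z by (simp add: third_def)
    have "relative_types Q p (p ! k) (p ! Suc k) z" using relative_types_iff[OF k] z by simp
    then show ?thesis
      using string(8) k unfolding Suc_eq_plus1[symmetric]
      by (metis (no_types, lifting) rooted_subquiver_third[OF z] verts_full_subquiver)
  qed
  have "\<exists>\<nu> H. numbering Q E f (w (length p)) L \<nu> H"
  proof (rule numbering_from_blocks)
    fix k assume k: "Suc k < length p"
    show "L (p ! Suc k) = Suc (L (p ! k) + card (hanging k))"
    proof (cases "\<exists>z. third k z")
      case True
      then show ?thesis using rooted by blast
    next
      case False
      then have "\<not> (\<exists>y z. relative_types Q p (p ! k) y z)" using relative_types_iff[OF k] by simp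
      then show ?thesis using string.hyps(7) k hanging_empty[OF False] by simp
    qed
  next
    fix k assume "k < length p"
    show "\<exists>\<mu> \<eta>. block_numbering L k \<mu> \<eta>"
    proof (cases "\<exists>z. third k z")
      case True
      then obtain z where z: "third k z" by blast
      then have zV: "z \<in> verts Q" "w (Suc k) \<in> E z" by (auto simp: third_def)
      obtain L' where L': "\<forall>v\<in>hanging k. L v = L (p ! k) + L' v"
        and IH: "\<And>c. tree_quiver (full_subquiver Q (hanging k)) E C \<Longrightarrow>
          free_end (full_subquiver Q (hanging k)) E z c \<Longrightarrow>
          \<exists>\<nu> H. numbering (full_subquiver Q (hanging k)) E z c L' \<nu> H"
        using rooted[OF z] by blast
      obtain \<nu> H where "numbering (full_subquiver Q (hanging k)) E z (w (Suc k)) L' \<nu> H"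
        using IH[of "w (Suc k)"] tree_quiver_branch[OF zV] free_end_branch[OF zV] hanging_eq[OF z] by auto
      then show ?thesis using block_numbering_shift[OF z _ L'] by blast
    qed (use block_numbering_empty in blast)
  qed (use string.hyps in simp)
  then show ?case using wc by simp
qed


section \<open>Roots\<close>

locale type_A_roots =
  fixes n :: nat and \<Phi> :: "'e::real_inner set" and \<alpha> :: "nat \<Rightarrow> 'e"
  assumes roots: "root_system_A n \<Phi> \<alpha>"
begin

lemma \<alpha>_root: "i \<in> {1..n} \<Longrightarrow> \<alpha> i \<in> \<Phi>"
  using roots by (auto simp: root_system_A_def simple_system_def)

lemma inner_\<alpha>:
  assumes "i \<in> {1..n}" "j \<in> {1..n}"
  shows "\<alpha> i \<bullet> \<alpha> j = 2 * of_bool (i = j) - of_bool (j = Suc i) - of_bool (i = Suc j)"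
  using roots assms \<alpha>_root[of i] by (auto simp: root_system_A_def)

lemma inner_\<alpha>_interval:
  assumes "i \<in> {1..n}" "1 \<le> c" "c \<le> d" "d \<le> Suc n"
  shows "\<alpha> i \<bullet> sum \<alpha> {c..<d} =
    of_bool (i = c) - of_bool (i = d) - of_bool (Suc i = c) + of_bool (Suc i = d)"
  using assms(3,4)
proof (induction d rule: dec_induct)
  case (step d)
  then have "d \<in> {1..n}" using assms by auto
  then show ?case
    using step inner_\<alpha>[OF assms(1), of d] by (simp add: inner_add_right)
qed simp

text \<open>In the standard model this is the inner product of \<epsilon>\<open>_a\<close> -
  \<epsilon>\<open>_b\<close> and \<epsilon>\<open>_c\<close> - \<epsilon>\<open>_d\<close> for an
  orthonormal family \<epsilon>.\<close>

lemma inner_intervals: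
  assumes "1 \<le> a" "a \<le> b" "b \<le> Suc n" "1 \<le> c" "c \<le> d" "d \<le> Suc n"
  shows "sum \<alpha> {a..<b} \<bullet> sum \<alpha> {c..<d} =
    of_bool (a = c) - of_bool (a = d) - of_bool (b = c) + of_bool (b = d)"
  using assms(2,3)
proof (induction b rule: dec_induct)
  case (step b)
  then have "b \<in> {1..n}" using assms by auto
  then show ?case
    using step inner_\<alpha>_interval[of b c d] assms by (simp add: inner_add_left)
qed simp

text \<open>The sum up to \<open>b - 1\<close> has inner product -1 with \<open>\<alpha> b\<close>,
  so reflecting it in \<open>\<alpha> b\<close> adds \<open>\<alpha> b\<close>.\<close>

lemma interval_root:
  assumes "1 \<le> a" "a < b" "b \<le> Suc n"
  shows "sum \<alpha> {a..<b} \<in> \<Phi>"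
proof -
  have "Suc a \<le> b" using assms by simp
  then show ?thesis using assms(3)
  proof (induction b rule: dec_induct)
    case base
    then show ?case using \<alpha>_root[of a] assms by simp
  next
    case (step b)
    let ?\<sigma> = "sum \<alpha> {a..<b}"
    have b: "b \<in> {1..n}" "a < b" using step assms by auto
    have "?\<sigma> \<in> \<Phi>" "\<alpha> b \<in> \<Phi>" using step \<alpha>_root[OF b(1)] by auto
    then have "?\<sigma> - (2 * (?\<sigma> \<bullet> \<alpha> b) / (\<alpha> b \<bullet> \<alpha> b)) *\<^sub>R \<alpha> b \<in> \<Phi>"
      using roots unfolding root_system_A_def root_system_def by blast
    moreover have "?\<sigma> \<bullet> \<alpha> b = - 1"
      using inner_\<alpha>_interval[OF b(1), of a b] b assms(1) by (simp add: inner_commute)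
    moreover have "\<alpha> b \<bullet> \<alpha> b = 2" using inner_\<alpha>[OF b(1,1)] by simp
    ultimately show ?case using b by simp
  qed
qed

section \<open>Lattice bases made of interval roots\<close>

lemma int_span_subset_span: "int_mod.span S \<subseteq> span S"
proof (rule int_mod.span_minimal)
  show "int_mod.subspace (span S)"
    by (rule int_mod.subspaceI) (simp_all add: span_zero span_add span_scale)
qed (rule span_superset)

lemma independent_imp_int_independent:
  assumes "independent S" shows "int_mod.independent S"
proof
  assume "int_mod.dependent S"
  then obtain t u where t: "finite t" "t \<subseteq> S" "(\<Sum>v\<in>t. of_int (u v) *\<^sub>R v) = 0" and "\<exists>v\<in>t. u v \<noteq> 0"
    unfolding int_mod.dependent_explicit by blast
  then have "\<exists>v\<in>t. real_of_int (u v) \<noteq> 0" by simp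
  then have "dependent S"
    unfolding dependent_explicit using t by (intro exI[of _ t] exI[of _ "\<lambda>v. real_of_int (u v)"]) simp
  then show False using assms by simp
qed

lemma roots_subset_int_span: "\<Phi> \<subseteq> int_mod.span (\<alpha> ` {1..n})"
proof
  fix \<rho> assume "\<rho> \<in> \<Phi>"
  then obtain c :: "'e \<Rightarrow> int" where "\<rho> = (\<Sum>\<delta>\<in>\<alpha> ` {1..n}. of_int (c \<delta>) *\<^sub>R \<delta>)"
    using roots by (auto simp: root_system_A_def simple_system_def)
  moreover have "(\<Sum>\<delta>\<in>\<alpha> ` {1..n}. of_int (c \<delta>) *\<^sub>R \<delta>) \<in> int_mod.span (\<alpha> ` {1..n})"
    by (intro int_mod.span_sum int_mod.span_scale int_mod.span_base)
  ultimately show "\<rho> \<in> int_mod.span (\<alpha> ` {1..n})" by simp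
qed

text \<open>The family is unitriangular with respect to the simple roots.\<close>

lemma interval_family_int_basis:
  fixes L H :: "'v \<Rightarrow> nat"
  assumes L: "bij_betw L V {1..n}" and H: "\<And>x. x \<in> V \<Longrightarrow> L x < H x \<and> H x \<le> Suc n"
    and \<beta>: "\<And>x. x \<in> V \<Longrightarrow> \<beta> x = sum \<alpha> {L x..<H x}"
  shows "int_basis_of \<beta> V (int_mod.span \<Phi>)"
proof -
  have finV: "finite V" and cardV: "card V = n" using L by (auto dest: bij_betw_finite bij_betw_same_card)
  have L1: "1 \<le> L x" if "x \<in> V" for x using L that by (auto simp: bij_betw_def)
  have \<alpha>_span: "\<alpha> i \<in> int_mod.span (\<beta> ` V)" if "i \<in> {1..n}" for i
    using that
  proof (induction "n - i" arbitrary: i rule: less_induct)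
    case less
    have "i \<in> L ` V" using L less.prems by (simp add: bij_betw_def)
    then obtain x where x: "x \<in> V" "L x = i" by blast
    have "\<beta> x = \<alpha> i + sum \<alpha> {Suc i..<H x}"
      using \<beta>[OF x(1)] H[OF x(1)] x(2) by (simp add: sum.atLeast_Suc_lessThan)
    then have eq: "\<alpha> i = \<beta> x - sum \<alpha> {Suc i..<H x}" by simp
    have "sum \<alpha> {Suc i..<H x} \<in> int_mod.span (\<beta> ` V)"
    proof (rule int_mod.span_sum)
      fix j assume "j \<in> {Suc i..<H x}"
      then have "j \<in> {1..n}" "n - j < n - i" using H[OF x(1)] less.prems by auto
      then show "\<alpha> j \<in> int_mod.span (\<beta> ` V)" using less.hyps by blast
    qed
    moreover have "\<beta> x \<in> int_mod.span (\<beta> ` V)" using x by (intro int_mod.span_base) simp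
    ultimately show ?case unfolding eq by (rule int_mod.span_diff[rotated])
  qed
  have "independent (\<alpha> ` {1..n})" "card (\<alpha> ` {1..n}) = n"
    using roots by (auto simp: root_system_A_def simple_system_def card_image)
  moreover have \<alpha>\<beta>: "\<alpha> ` {1..n} \<subseteq> span (\<beta> ` V)" using \<alpha>_span int_span_subset_span by blast
  \<comment> \<open>Injectivity and independence both come from counting: a maximal independent
    subset spans the \<open>n\<close> independent simple roots, hence has at least \<open>n\<close>
    elements, while the family has only \<open>n\<close> members.\<close>
  obtain B where B: "B \<subseteq> \<beta> ` V" "independent B" "\<beta> ` V \<subseteq> span B"
    using maximal_independent_subset[of "\<beta> ` V"] by blast
  have finB: "finite B" using B(1) finV by (blast intro: finite_subset)
  have "\<alpha> ` {1..n} \<subseteq> span B" using \<alpha>\<beta> span_minimal[OF B(3) subspace_span] by blast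
  ultimately have "n \<le> card B" using independent_span_bound[OF finB] by metis
  moreover have "card B \<le> card (\<beta> ` V)" using B(1) finV by (intro card_mono) auto
  moreover have "card (\<beta> ` V) \<le> n" using card_image_le[OF finV] cardV by metis
  ultimately have c: "card (\<beta> ` V) = n" "card B = card (\<beta> ` V)" by auto
  have "inj_on \<beta> V" using c(1) cardV finV by (intro eq_card_imp_inj_on) auto
  moreover have "B = \<beta> ` V" using card_subset_eq[OF _ B(1) c(2)] finV by blast
  then have "int_mod.independent (\<beta> ` V)" using B(2) independent_imp_int_independent by blast
  moreover have "int_mod.span (\<beta> ` V) = int_mod.span \<Phi>"
  proof
    have "\<beta> ` V \<subseteq> \<Phi>" using \<beta> interval_root H L1 by auto
    then show "int_mod.span (\<beta> ` V) \<subseteq> int_mod.span \<Phi>" by (rule int_mod.span_mono)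
    have "int_mod.span (\<alpha> ` {1..n}) \<subseteq> int_mod.span (\<beta> ` V)"
      by (rule int_mod.span_minimal) (use \<alpha>_span in \<open>auto intro: int_mod.subspace_span\<close>)
    then show "int_mod.span \<Phi> \<subseteq> int_mod.span (\<beta> ` V)"
      using roots_subset_int_span by (intro int_mod.span_minimal int_mod.subspace_span) blast
  qed
  ultimately show ?thesis by (simp add: int_basis_of_def)
qed

end

section \<open>The companion basis attached to a numbered tree\<close>

context tree_quiver
begin

text \<open>Every complementary vertex \<open>y\<close> of \<open>x\<close> satisfies
  \<open>H x = Suc (L y)\<close>. As \<open>L\<close> is injective, it is unique, so the definite
  description is proper although \<open>x\<close> may lie on two 3-cycles.\<close>

lemma label_root_numbering:
  assumes num: "numbering Q E f c L \<nu> H" and x: "x \<in> verts Q"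
  shows "label_root Q L \<alpha> x = sum \<alpha> {L x..<H x}"
proof (cases "primary_vertex Q L x")
  case True
  then obtain y where y: "complementary_of Q L x y" by (auto simp: primary_vertex_def)
  have H: "H x = Suc (L y') \<and> y' \<in> verts Q" if "complementary_of Q L x y'" for y'
    using that num three_cycle_iff unfolding complementary_of_def numbering_def by metis
  have "(THE y. complementary_of Q L x y) = y"
  proof (rule the_equality)
    fix y' assume "complementary_of Q L x y'"
    then have "L y' = L y" "y' \<in> verts Q" "y \<in> verts Q" using H[of y] H[of y'] y by auto
    then show "y' = y" using num by (auto simp: numbering_def inj_on_def)
  qed (rule y)
  then show ?thesis using True H[OF y] by (simp add: label_root_def atLeastLessThanSuc_atLeastAtMost)
next
  case False
  then have "\<not> (\<exists>y z. three_cycle Q x y z \<and> L x < L y \<and> L y < L z)"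
    by (auto simp: primary_vertex_def complementary_of_def)
  then have "H x = Suc (L x)" using num x unfolding numbering_def by blast
  then show ?thesis using False by (simp add: label_root_def)
qed

lemma companion_basis_numbering:
  assumes num: "numbering Q E f c L \<nu> H" and n: "card (verts Q) = n"
    and roots: "root_system_A n \<Phi> \<alpha>"
  shows "companion_basis Q \<Phi> (label_root Q L \<alpha>)"
proof -
  interpret type_A_roots n \<Phi> \<alpha> by unfold_locales (rule roots)
  have inj_\<nu>: "inj_on \<nu> (\<Union> (E ` verts Q))" and inj_L: "inj_on L (verts Q)"
    and LH: "\<And>x. x \<in> verts Q \<Longrightarrow> \<nu> ` E x = {L x, H x} \<and> L x < H x \<and> 1 \<le> L x \<and> H x \<le> Suc n"
    using num n by (simp_all add: numbering_def)
  note \<beta> = label_root_numbering[OF num, of _ \<alpha>]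
  have "L ` verts Q \<subseteq> {1..n}" using LH by fastforce
  moreover have "card (L ` verts Q) = n" using card_image[OF inj_L] n by simp
  ultimately have "L ` verts Q = {1..n}" by (intro card_subset_eq) auto
  then have bij: "bij_betw L (verts Q) {1..n}" using inj_L by (simp add: bij_betw_def)
  show ?thesis
    unfolding companion_basis_def
  proof (intro conjI ballI impI)
    show "label_root Q L \<alpha> ` verts Q \<subseteq> \<Phi>" using \<beta> LH interval_root by auto
    show "int_basis_of (label_root Q L \<alpha>) (verts Q) (int_mod.span \<Phi>)"
      using interval_family_int_basis[OF bij, of H] LH \<beta> by blast
  next
    fix x y assume x: "x \<in> verts Q" and y: "y \<in> verts Q" and "x \<noteq> y"
    then have ne: "L x \<noteq> L y" using inj_L by (auto simp: inj_on_def)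
    have "\<nu> ` (E x \<inter> E y) = \<nu> ` E x \<inter> \<nu> ` E y"
      by (rule inj_on_image_Int[OF inj_\<nu>]) (use x y in auto)
    then have "E x \<inter> E y = {} \<longleftrightarrow> {L x, H x} \<inter> {L y, H y} = {}"
      using LH[OF x] LH[OF y] by auto
    then have edges: "edges Q x y = of_bool (L x = H y \<or> H x = L y \<or> H x = H y)"
      using edges_eq[OF x y \<open>x \<noteq> y\<close>] ne by auto
    have "label_root Q L \<alpha> x \<bullet> label_root Q L \<alpha> y =
        of_bool (L x = L y) - of_bool (L x = H y) - of_bool (H x = L y) + of_bool (H x = H y)"
      using inner_intervals[of "L x" "H x" "L y" "H y"] LH[OF x] LH[OF y] \<beta> x y by simp
    \<comment> \<open>Since \<open>L x\<close> and \<open>L y\<close> differ and \<open>L\<close> is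
      below \<open>H\<close> on each edge, at most one of the remaining three coincidences holds, so
      terms neither cancel nor add up.\<close>
    then show "\<bar>label_root Q L \<alpha> x \<bullet> label_root Q L \<alpha> y\<bar> = real (edges Q x y)"
      unfolding edges using ne LH[OF x] LH[OF y] by auto
  qed
qed

end

theorem theorem3p4:
  fixes \<Gamma> :: "'v quiver" and L :: "'v \<Rightarrow> nat" and e f :: 'v and n :: nat
    and \<Phi> :: "'e::real_inner set" and \<alpha> :: "nat \<Rightarrow> 'e"
  assumes "mutation_type_A n \<Gamma>"
    and "labelling \<Gamma> e f L"
    and "root_system_A n \<Phi> \<alpha>"
  shows "companion_basis \<Gamma> \<Phi> (label_root \<Gamma> L \<alpha>)"
proof -
  obtain E C where n: "card (verts \<Gamma>) = n" and "tree_quiver \<Gamma> E C"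
    using mutation_type_A_tree_quiver[OF assms(1)] by blast
  then interpret tree_quiver \<Gamma> E C by simp
  obtain c where c: "free_end \<Gamma> E f c"
    using assms(2)
  proof cases
    case (single)
    then have "f \<in> verts \<Gamma>" by simp
    \<comment> \<open>Both ends of the only tree edge are leaves, so either one will do.\<close>
    then obtain a where "a \<in> E f" using card_E by fastforce
    then show ?thesis using that single by (auto simp: free_end_def)
  next
    case (string p)
    then show ?thesis using end_vertex_free_end that by blast
  qed
  obtain \<nu> H where "numbering \<Gamma> E f c L \<nu> H"
    using labelling_numbering[OF assms(2) tree_quiver_axioms c] by blast
  then show ?thesis by (rule companion_basis_numbering[OF _ n assms(3)])
qed

end
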